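(* Let $(G,\rho)$ be a Polish metric space which is dense-in-itself, and let $\mu$ be a diffused Borel probability measure defined in $(G,\rho)$. Then there exist a metric $\rho_{\varphi}$ and a group operation $\odot_{\varphi}$ in $G$ such that the following three conditions hold: (i) the class of Borel measurable subsets of $G$ generated by the metric $\rho_{\varphi}$ coincides with the class of Borel measurable subsets of $G$ generated by the metric $\rho$; (ii) $(G,\rho_{\varphi},\odot_{\varphi})$ is a compact Polish group; (iii) $\mu$ is a two-sided invariant (in particular left invariant and right invariant) probability Haar measure in $(G,\rho_{\varphi},\odot_{\varphi})$.
   Context: A Polish metric space is a complete separable metric space. A space is dense-in-itself if it has no isolated points. A measure is diffused if it vanishes on all singletons. A Polish group $(G,\rho,\odot)$ is a group $(G,\odot)$ with a complete separable metric $\rho$ such that the map $G\times G\to G$, $(x,y)\mapsto x^{-1}\odot y$, is continuous; it is compact if it is compact in the metric topology. A Borel measure $\mu$ on a Polish group is left invariant if $\mu(g\odot E)=\mu(E)$, right invariant if $\mu(E\odot g)=\mu(E)$, and two-sided invariant if $\mu(g_1\odot E\odot g_2)=\mu(E)$, for all group elements $g,g_1,g_2$ and all Borel sets $E$. A left (right, two-sided) invariant Haar measure in a locally compact Polish group is a Borel measure $\mu$ that is: diffused; left (right, two-sided) invariant; outer regular ($\mu(E)=\inf\{\mu(U):E\subseteq U,\ U\text{ open}\}$ for every Borel $E$); inner regular ($\mu(E)=\sup\{\mu(F):F\subseteq E,\ F\text{ compact}\}$ for every Borel $E$); and finite on every compact set. *)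

theory Defs
  imports
    "HOL-Analysis.Analysis"
    "HOL-Probability.Probability_Measure"
    "HOL-Algebra.Coset"
begin

text \<open>
  Metric spaces, groups and measures are carrier-based throughout, because the theorem puts
  a second metric and a group operation on one and the same underlying set.
\<close>

definition polish_metric_space :: "'a set \<Rightarrow> ('a \<Rightarrow> 'a \<Rightarrow> real) \<Rightarrow> bool" where
  "polish_metric_space M d \<longleftrightarrow>
     Metric_space M d \<and> Metric_space.mcomplete M d \<and> separable_space (Metric_space.mtopology M d)"

definition dense_in_itself :: "'a topology \<Rightarrow> bool" where
  "dense_in_itself X \<longleftrightarrow> \<not> (\<exists>x\<in>topspace X. openin X {x})"

definition borel_sets :: "'a topology \<Rightarrow> 'a set set" where
  "borel_sets X = sigma_sets (topspace X) {U. openin X U}"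

definition borel_measure :: "'a topology \<Rightarrow> 'a measure \<Rightarrow> bool" where
  "borel_measure X \<mu> \<longleftrightarrow> space \<mu> = topspace X \<and> sets \<mu> = borel_sets X"

definition diffused :: "'a measure \<Rightarrow> bool" where
  "diffused \<mu> \<longleftrightarrow> (\<forall>x\<in>space \<mu>. emeasure \<mu> {x} = 0)"

definition polish_group :: "('a, 'b) monoid_scheme \<Rightarrow> ('a \<Rightarrow> 'a \<Rightarrow> real) \<Rightarrow> bool" where
  "polish_group H d \<longleftrightarrow>
     group H \<and> polish_metric_space (carrier H) d \<and>
     (let X = Metric_space.mtopology (carrier H) d in
        continuous_map (prod_topology X X) X (\<lambda>(x, y). inv\<^bsub>H\<^esub> x \<otimes>\<^bsub>H\<^esub> y))"

definition compact_polish_group :: "('a, 'b) monoid_scheme \<Rightarrow> ('a \<Rightarrow> 'a \<Rightarrow> real) \<Rightarrow> bool" where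
  "compact_polish_group H d \<longleftrightarrow>
     polish_group H d \<and> compact_space (Metric_space.mtopology (carrier H) d)"

definition left_invariant :: "('a, 'b) monoid_scheme \<Rightarrow> 'a measure \<Rightarrow> bool" where
  "left_invariant H \<mu> \<longleftrightarrow>
     (\<forall>g\<in>carrier H. \<forall>E\<in>sets \<mu>. emeasure \<mu> (g <#\<^bsub>H\<^esub> E) = emeasure \<mu> E)"

definition right_invariant :: "('a, 'b) monoid_scheme \<Rightarrow> 'a measure \<Rightarrow> bool" where
  "right_invariant H \<mu> \<longleftrightarrow>
     (\<forall>g\<in>carrier H. \<forall>E\<in>sets \<mu>. emeasure \<mu> (E #>\<^bsub>H\<^esub> g) = emeasure \<mu> E)"

definition two_sided_invariant :: "('a, 'b) monoid_scheme \<Rightarrow> 'a measure \<Rightarrow> bool" where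
  "two_sided_invariant H \<mu> \<longleftrightarrow>
     (\<forall>g\<^sub>1\<in>carrier H. \<forall>g\<^sub>2\<in>carrier H. \<forall>E\<in>sets \<mu>.
        emeasure \<mu> ((g\<^sub>1 <#\<^bsub>H\<^esub> E) #>\<^bsub>H\<^esub> g\<^sub>2) = emeasure \<mu> E)"

definition outer_regular :: "'a topology \<Rightarrow> 'a measure \<Rightarrow> bool" where
  "outer_regular X \<mu> \<longleftrightarrow>
     (\<forall>E\<in>sets \<mu>. emeasure \<mu> E = (INF U\<in>{U. E \<subseteq> U \<and> openin X U}. emeasure \<mu> U))"

definition inner_regular :: "'a topology \<Rightarrow> 'a measure \<Rightarrow> bool" where
  "inner_regular X \<mu> \<longleftrightarrow>
     (\<forall>E\<in>sets \<mu>. emeasure \<mu> E = (SUP F\<in>{F. F \<subseteq> E \<and> compactin X F}. emeasure \<mu> F))"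

text \<open>
  The requirements on a Haar measure other than invariance.  The ambient locally compact
  Polish group enters only through its topology \<open>X\<close>.
\<close>

definition haar_regularity :: "'a topology \<Rightarrow> 'a measure \<Rightarrow> bool" where
  "haar_regularity X \<mu> \<longleftrightarrow>
     borel_measure X \<mu> \<and> diffused \<mu> \<and> outer_regular X \<mu> \<and> inner_regular X \<mu> \<and>
     (\<forall>K. compactin X K \<longrightarrow> emeasure \<mu> K < \<infinity>)"

definition left_haar_measure ::
    "('a, 'b) monoid_scheme \<Rightarrow> ('a \<Rightarrow> 'a \<Rightarrow> real) \<Rightarrow> 'a measure \<Rightarrow> bool" where
  "left_haar_measure H d \<mu> \<longleftrightarrow>
     haar_regularity (Metric_space.mtopology (carrier H) d) \<mu> \<and> left_invariant H \<mu>"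

definition right_haar_measure ::
    "('a, 'b) monoid_scheme \<Rightarrow> ('a \<Rightarrow> 'a \<Rightarrow> real) \<Rightarrow> 'a measure \<Rightarrow> bool" where
  "right_haar_measure H d \<mu> \<longleftrightarrow>
     haar_regularity (Metric_space.mtopology (carrier H) d) \<mu> \<and> right_invariant H \<mu>"

definition two_sided_haar_measure ::
    "('a, 'b) monoid_scheme \<Rightarrow> ('a \<Rightarrow> 'a \<Rightarrow> real) \<Rightarrow> 'a measure \<Rightarrow> bool" where
  "two_sided_haar_measure H d \<mu> \<longleftrightarrow>
     haar_regularity (Metric_space.mtopology (carrier H) d) \<mu> \<and> two_sided_invariant H \<mu>"

end

theory Submission
  imports Defs "HOL-Probability.Distribution_Functions"
begin

text \<open>
  It suffices to find a bijection \<open>\<phi>\<close> from \<open>G\<close> onto \<open>[0, 1)\<close> that is Borel in both directions and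
  carries \<open>\<mu>\<close> to Lebesgue measure: wrapping \<open>[0, 1)\<close> around the unit circle then allows one to pull
  back to \<open>G\<close> the metric, the multiplication and the Haar measure of the circle group
  (\<open>compact_polish_pullback\<close>, \<open>haar_regularity_pullback\<close>, \<open>emeasure_lborel_rotation\<close>).

  The bijection (\<open>isomorphism_with_unit_interval\<close>) is built in three steps.

  First (\<open>polish_null_embedding\<close>), a point \<open>x\<close> of \<open>G\<close> is encoded by the ternary expansion, with digits
  0 and 1, that records which balls of radius \<open>1 / (k + 1)\<close> around the points of a countable dense set
  contain \<open>x\<close>.  By completeness the codes that occur are described by countably many conditions on the
  digits, so the image of \<open>G\<close> is Borel and its Borel structure is inherited; it is Lebesgue null
  because the digit 2 is missing.

  Second (\<open>injection_into_interval\<close>), the image of \<open>\<mu>\<close> on the real line has no atoms, so its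
  distribution function \<open>F\<close> is continuous and carries it to Lebesgue measure on \<open>[0, 1]\<close>.  It fails to
  be injective only over countably many values.  On the null set of points that cause trouble, \<open>F\<close> is
  replaced by the identity: the embedded copy of \<open>G\<close> is itself null, so points left in place add no
  measure, and they meet no other value if \<open>F\<close> is considered troublesome also where its value lies in
  the copy.  This yields a measure-preserving injection of \<open>G\<close> onto a Borel set \<open>R\<close> of full
  measure in \<open>[0, 1)\<close>.

  Third (\<open>interval_full_measure_isomorphism\<close>), the null set \<open>[0, 1) - R\<close> is absorbed in the manner of
  Hilbert's hotel.  An injection \<open>j\<close> of \<open>[0, 1)\<close> into \<open>R\<close> that preserves null sets is obtained by
  inverting the distribution function of the uniform measure on a compact set of positive measure in
  \<open>R\<close>; moving the orbit of \<open>[0, 1) - R\<close> under \<open>j\<close> one step along, and nothing else, maps \<open>[0, 1)\<close>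
  bijectively onto \<open>R\<close>.
\<close>

section \<open>Ternary codes of binary sequences\<close>

definition ternary :: "(nat \<Rightarrow> bool) \<Rightarrow> real" where
  "ternary b = (\<Sum>n. of_bool (b n) / 3 ^ Suc n)"

text \<open>
  On the numbers \<open>ternary b\<close> the leading digit is 1 exactly from \<open>1/3\<close> on; removing it and
  scaling by 3 exposes the next one.  On other arguments the values are meaningless but still Borel.
\<close>

primrec ternary_digit :: "nat \<Rightarrow> real \<Rightarrow> bool" where
  "ternary_digit 0 y \<longleftrightarrow> 1 / 3 \<le> y"
| "ternary_digit (Suc n) y \<longleftrightarrow> ternary_digit n (3 * y - of_bool (1 / 3 \<le> y))"

lemma ternary_majorant: "(\<lambda>n. 1 / 3 ^ Suc n) sums (1 / 2 :: real)"
  using sums_mult[OF geometric_sums[of "1/3::real"], of "1/3"] by (simp add: power_one_over divide_simps)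

lemma ternary_summable: "summable (\<lambda>n. of_bool (b n) / 3 ^ Suc n :: real)"
  by (rule summable_comparison_test'[OF sums_summable[OF ternary_majorant], where N=0]) auto

lemma ternary_bounds: "0 \<le> ternary b" "ternary b \<le> 1 / 2"
proof -
  show "0 \<le> ternary b" unfolding ternary_def by (rule suminf_nonneg[OF ternary_summable]) auto
  have "ternary b \<le> (\<Sum>n. 1 / 3 ^ Suc n)" unfolding ternary_def
    by (rule suminf_le[OF _ ternary_summable sums_summable[OF ternary_majorant]]) auto
  then show "ternary b \<le> 1 / 2" using sums_unique[OF ternary_majorant] by simp
qed

lemma ternary_shift: "ternary b = (of_bool (b 0) + ternary (\<lambda>n. b (Suc n))) / 3"
proof -
  have "ternary b = of_bool (b 0) / 3 + (\<Sum>n. of_bool (b (Suc n)) / 3 ^ Suc (Suc n))"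
    unfolding ternary_def using suminf_split_head[OF ternary_summable[of b]] by simp
  also have "(\<Sum>n. of_bool (b (Suc n)) / 3 ^ Suc (Suc n) :: real) = ternary (\<lambda>n. b (Suc n)) / 3"
    unfolding ternary_def using suminf_divide[OF ternary_summable, of "\<lambda>n. b (Suc n)" 3] by simp
  finally show ?thesis by (simp add: add_divide_distrib)
qed

lemma ternary_first_digit: "1 / 3 \<le> ternary b \<longleftrightarrow> b 0"
  using ternary_shift[of b] ternary_bounds[of "\<lambda>n. b (Suc n)"] by (cases "b 0") auto

lemma ternary_digit_ternary: "ternary_digit n (ternary b) = b n"
proof (induction n arbitrary: b)
  case (Suc n)
  have "3 * ternary b - of_bool (1 / 3 \<le> ternary b) = ternary (\<lambda>n. b (Suc n))"
    using ternary_shift[of b] ternary_first_digit[of b] by auto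
  then show ?case using Suc by simp
qed (use ternary_first_digit in simp)

lemma ternary_digit_measurable [measurable]: "Measurable.pred borel (ternary_digit n)"
proof (induction n)
  case (Suc n)
  note Suc[measurable]
  show ?case unfolding ternary_digit.simps of_bool_def by measurable
qed simp

lemma ternary_measurable:
  assumes [measurable]: "\<And>n. Measurable.pred M (\<lambda>x. b x n)"
  shows "(\<lambda>x. ternary (b x)) \<in> borel_measurable M"
  unfolding ternary_def of_bool_def by measurable

text \<open>
  A number is a code exactly when decoding and encoding again reproduces it.
\<close>

lemma range_ternary_borel: "range ternary \<in> sets borel"
proof -
  have "range ternary = {y. ternary (\<lambda>n. ternary_digit n y) = y}"
    by (auto simp: ternary_digit_ternary) (metis rangeI)
  moreover have [measurable]: "(\<lambda>y. ternary (\<lambda>n. ternary_digit n y)) \<in> borel_measurable borel"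
    by (rule ternary_measurable) measurable
  ultimately show ?thesis by simp
qed

text \<open>
  The set of codes is covered by two copies of itself scaled by \<open>1/3\<close>, so its measure \<open>m\<close> satisfies
  \<open>m \<le> 2/3 m\<close>.
\<close>

lemma range_ternary_null: "emeasure lborel (range ternary) = 0"
proof -
  let ?T = "range ternary"
  have bor: "?T \<in> sets borel" by (rule range_ternary_borel)
  have scale: "emeasure lborel ((\<lambda>y. (c + y) / 3) ` ?T) = ennreal (1/3) * emeasure lborel ?T"
    and meas: "(\<lambda>y. (c + y) / 3) ` ?T \<in> sets borel" for c :: real
  proof -
    have eq: "(\<lambda>y. (c + y) / 3) ` ?T = (\<lambda>x. (-c) + 3 * x) -` ?T"
    proof (rule Set.set_eqI)
      fix x
      have "x = (c + y) / 3 \<longleftrightarrow> - c + 3 * x = y" for y by auto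
      then show "x \<in> (\<lambda>y. (c + y) / 3) ` ?T \<longleftrightarrow> x \<in> (\<lambda>x. - c + 3 * x) -` ?T"
        unfolding image_iff vimage_eq by blast
    qed
    show "(\<lambda>y. (c + y) / 3) ` ?T \<in> sets borel"
      unfolding eq by (rule measurable_sets_borel[OF _ bor]) measurable
    have "emeasure lborel ?T = ennreal 3 * emeasure lborel ((\<lambda>x. (-c) + 3 * x) -` ?T)"
      using bor by (subst lborel_real_affine[of 3 "-c"]) (auto simp: emeasure_density nn_integral_cmult emeasure_distr
         nn_integral_distr  nn_integral_cmult_indicator)
    then have "ennreal (1/3) * emeasure lborel ?T = (ennreal (1/3) * ennreal 3) * emeasure lborel ((\<lambda>y. (c + y) / 3) ` ?T)"
      by (simp add: eq mult.assoc)
    also have "ennreal (1/3) * ennreal 3 = ennreal (1/3 * 3)" by (rule ennreal_mult[symmetric]) auto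
    finally show "emeasure lborel ((\<lambda>y. (c + y) / 3) ` ?T) = ennreal (1/3) * emeasure lborel ?T" by simp
  qed
  have "emeasure lborel ?T \<le> emeasure lborel {0..1/2::real}"
    by (rule emeasure_mono) (use ternary_bounds in auto)
  then have fin: "emeasure lborel ?T \<noteq> \<infinity>" by (auto simp: top_unique)
  have "?T \<subseteq> (\<lambda>y. (0 + y) / 3) ` ?T \<union> (\<lambda>y. (1 + y) / 3) ` ?T"
    using ternary_shift by (force simp: image_iff)
  then have "emeasure lborel ?T \<le> emeasure lborel ((\<lambda>y. (0 + y) / 3) ` ?T \<union> (\<lambda>y. (1 + y) / 3) ` ?T)"
    by (intro emeasure_mono) (use meas[of 0] meas[of 1] in auto)
  also have "\<dots> \<le> emeasure lborel ((\<lambda>y. (0 + y) / 3) ` ?T) + emeasure lborel ((\<lambda>y. (1 + y) / 3) ` ?T)"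
    by (intro emeasure_subadditive) (use meas[of 0] meas[of 1] in auto)
  also have "\<dots> = ennreal (1/3) * emeasure lborel ?T + ennreal (1/3) * emeasure lborel ?T"
    using scale[of 0] scale[of 1] by simp
  finally have "emeasure lborel ?T \<le> ennreal (1/3) * emeasure lborel ?T + ennreal (1/3) * emeasure lborel ?T" .
  then obtain r where "r \<ge> 0" "emeasure lborel ?T = ennreal r"
    "ennreal r \<le> ennreal (1/3) * ennreal r + ennreal (1/3) * ennreal r"
    using fin by (metis ennreal_cases infinity_ennreal_def)
  then show ?thesis by (simp flip: ennreal_mult ennreal_plus add: ennreal_le_iff)
qed

section \<open>Embedding a Polish space as a null set\<close>

text \<open>
  Direct images commute with complements only for injective maps; then the sets with measurable
  image form a \<open>\<sigma>\<close>-algebra.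
\<close>

lemma image_sigma_sets_inj:
  assumes "\<G> \<subseteq> Pow \<Omega>" "inj_on f \<Omega>" "f ` \<Omega> \<in> sets N" "\<And>A. A \<in> \<G> \<Longrightarrow> f ` A \<in> sets N"
    and "A \<in> sigma_sets \<Omega> \<G>"
  shows "f ` A \<in> sets N"
  using assms(5)
proof (induction rule: sigma_sets.induct)
  case (Compl A)
  then have "A \<subseteq> \<Omega>" using sigma_sets_into_sp[OF assms(1)] by blast
  then have "f ` (\<Omega> - A) = f ` \<Omega> - f ` A" using assms(2) by (simp add: inj_on_image_set_diff)
  then show ?case using Compl assms(3) by auto
qed (use assms in \<open>auto simp: image_UN\<close>)

text \<open>
  \<open>Q i k\<close> is read as membership of an unknown point in the ball of radius \<open>1 / (k + 1)\<close> around \<open>c i\<close>.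
  The first two conditions make the centres of chosen balls with shrinking radii a Cauchy sequence; the
  third is monotonicity and openness together: a ball is chosen exactly when it contains, with room to
  spare, a chosen ball.  All quantifiers range over natural numbers, so the condition is Borel in \<open>Q\<close>.
\<close>

definition coherent_balls :: "('a \<Rightarrow> 'a \<Rightarrow> real) \<Rightarrow> (nat \<Rightarrow> 'a) \<Rightarrow> (nat \<Rightarrow> nat \<Rightarrow> bool) \<Rightarrow> bool" where
  "coherent_balls d c Q \<longleftrightarrow>
     (\<forall>i j k l. Q i k \<and> Q j l \<longrightarrow> d (c i) (c j) < 1 / real (Suc k) + 1 / real (Suc l)) \<and>
     (\<forall>k. \<exists>i. Q i k) \<and>
     (\<forall>i k. Q i k \<longleftrightarrow> (\<exists>j l. Q j l \<and> d (c i) (c j) + 1 / real (Suc l) < 1 / real (Suc k)))"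

lemma reciprocal_Suc_less:
  assumes "0 < (e::real)" obtains k where "1 / real (Suc k) < e"
  using reals_Archimedean[OF assms] by (auto simp: inverse_eq_divide)

context Metric_space begin

lemma coherent_balls_of_point:
  assumes c: "\<And>i. c i \<in> M" and dense: "\<And>x e. x \<in> M \<Longrightarrow> 0 < e \<Longrightarrow> \<exists>i. d (c i) x < e"
    and x: "x \<in> M"
  shows "coherent_balls d c (\<lambda>i k. d (c i) x < 1 / real (Suc k))"
  unfolding coherent_balls_def
proof (intro conjI allI impI iffI)
  fix i j k l
  assume "d (c i) x < 1 / real (Suc k) \<and> d (c j) x < 1 / real (Suc l)"
  then show "d (c i) (c j) < 1 / real (Suc k) + 1 / real (Suc l)"
    using triangle'[OF c[of i] x c[of j]] by linarith
next
  show "\<exists>i. d (c i) x < 1 / real (Suc k)" for k using dense[OF x] by simp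
next
  fix i k assume "d (c i) x < 1 / real (Suc k)"
  then have "0 < (1 / real (Suc k) - d (c i) x) / 2" by simp
  then obtain l where l: "1 / real (Suc l) < (1 / real (Suc k) - d (c i) x) / 2"
    by (rule reciprocal_Suc_less)
  obtain j where j: "d (c j) x < 1 / real (Suc l)" using dense[OF x, of "1 / real (Suc l)"] by auto
  have "d (c i) (c j) \<le> d (c i) x + d (c j) x" using triangle'[OF c[of i] x c[of j]] .
  then have "d (c i) (c j) + 1 / real (Suc l) < 1 / real (Suc k)"
    using l j unfolding less_divide_eq_numeral1 by argo
  then show "\<exists>j l. d (c j) x < 1 / real (Suc l) \<and> d (c i) (c j) + 1 / real (Suc l) < 1 / real (Suc k)"
    using j by blast
next
  fix i k assume "\<exists>j l. d (c j) x < 1 / real (Suc l) \<and> d (c i) (c j) + 1 / real (Suc l) < 1 / real (Suc k)"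
  then obtain j l where "d (c j) x < 1 / real (Suc l)" "d (c i) (c j) + 1 / real (Suc l) < 1 / real (Suc k)"
    by blast
  then show "d (c i) x < 1 / real (Suc k)"
    using triangle[OF c[of i] c[of j] x] by linarith
qed

text \<open>
  Completeness supplies the point: it is the limit of the centres of one chosen ball for each radius.
  Compatibility puts the limit into the closure of each chosen ball, and the third
  condition turns the closed ball into an open one.
\<close>

lemma point_of_coherent_balls:
  assumes "mcomplete" and c: "\<And>i. c i \<in> M" and Q: "coherent_balls d c Q"
  obtains x where "x \<in> M" "\<And>i k. Q i k \<longleftrightarrow> d (c i) x < 1 / real (Suc k)"
proof -
  have compat: "Q i k \<Longrightarrow> Q j l \<Longrightarrow> d (c i) (c j) < 1 / real (Suc k) + 1 / real (Suc l)" for i j k l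
    using Q unfolding coherent_balls_def by blast
  have round: "Q i k \<longleftrightarrow> (\<exists>j l. Q j l \<and> d (c i) (c j) + 1 / real (Suc l) < 1 / real (Suc k))" for i k
    using Q unfolding coherent_balls_def by blast
  obtain I where I: "\<And>k. Q (I k) k" using Q unfolding coherent_balls_def by metis
  have "MCauchy (\<lambda>n. c (I n))"
    unfolding MCauchy_def
  proof (intro conjI allI impI)
    fix e :: real assume "0 < e"
    then obtain N where N: "1 / real (Suc N) < e / 2" using reciprocal_Suc_less[of "e / 2"] by auto
    show "\<exists>N. \<forall>n n'. N \<le> n \<longrightarrow> N \<le> n' \<longrightarrow> d (c (I n)) (c (I n')) < e"
    proof (intro exI allI impI)
      fix m n assume "N \<le> m" "N \<le> n"
      then have "1 / real (Suc m) \<le> 1 / real (Suc N)" "1 / real (Suc n) \<le> 1 / real (Suc N)"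
        by (simp_all add: frac_le)
      then show "d (c (I m)) (c (I n)) < e" using compat[OF I I, of m n] N by argo
    qed
  qed (use c in auto)
  then obtain x where x: "limitin mtopology (\<lambda>n. c (I n)) x sequentially"
    using assms(1) unfolding mcomplete_def by blast
  then have xM: "x \<in> M" by (simp add: limitin_mspace)
  have ev: "\<forall>\<^sub>F n in sequentially. d (c (I n)) x < e" if "0 < e" for e
    using x that unfolding limitin_metric by (force elim: eventually_mono)
  \<comment> \<open>Every ball in the family contains the limit, at least in its closure.\<close>
  have closed: "d (c i) x \<le> 1 / real (Suc k)" if "Q i k" for i k
  proof (rule field_le_epsilon)
    fix e :: real assume e: "0 < e"
    then obtain N where N: "1 / real (Suc N) < e / 2" using reciprocal_Suc_less[of "e / 2"] by auto
    have "\<forall>\<^sub>F n in sequentially. n \<ge> N \<and> d (c (I n)) x < e / 2"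
      using ev[of "e / 2"] e by (auto intro: eventually_conj eventually_ge_at_top)
    then obtain n where n: "n \<ge> N" "d (c (I n)) x < e / 2"
      using eventually_happens'[OF sequentially_bot] by blast
    have "1 / real (Suc n) \<le> 1 / real (Suc N)" using n by (simp add: frac_le)
    then show "d (c i) x \<le> 1 / real (Suc k) + e"
      using compat[OF that I, of n] triangle[OF c[of i] c[of "I n"] xM] N n by argo
  qed
  have "Q i k \<longleftrightarrow> d (c i) x < 1 / real (Suc k)" for i k
  proof
    assume "Q i k"
    then obtain j l where jl: "Q j l" "d (c i) (c j) + 1 / real (Suc l) < 1 / real (Suc k)"
      using round by blast
    show "d (c i) x < 1 / real (Suc k)"
      using closed[OF jl(1)] triangle[OF c[of i] c[of j] xM] jl(2) by argo
  next
    assume less: "d (c i) x < 1 / real (Suc k)"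
    define e where "e = (1 / real (Suc k) - d (c i) x) / 2"
    have e: "0 < e" using less by (simp add: e_def)
    obtain N where N: "1 / real (Suc N) < e" using e by (rule reciprocal_Suc_less)
    have "1 / real (Suc N) \<ge> d (c (I N)) x" using closed[OF I] .
    then have "d (c i) (c (I N)) + 1 / real (Suc N) < 1 / real (Suc k)"
      using triangle'[OF c[of i] xM c[of "I N"]] N unfolding e_def by argo
    then show "Q i k" using round I by blast
  qed
  then show ?thesis using that xM by blast
qed

end

text \<open>
  That the image is Borel comes from completeness; in general an injective Borel map has Borel images
  only by the Lusin-Souslin theorem, which the explicit description of the codes avoids.
\<close>

lemma polish_null_embedding:
  assumes polish: "polish_metric_space G \<rho>" and borel: "borel_measure (Metric_space.mtopology G \<rho>) \<mu>"
    and ne: "G \<noteq> {}"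
  obtains f :: "'a \<Rightarrow> real" where "f \<in> borel_measurable \<mu>" "inj_on f G" "f ` G \<subseteq> {0..1/2}"
    "\<And>A. A \<in> sets \<mu> \<Longrightarrow> f ` A \<in> sets borel" "emeasure lborel (f ` G) = 0"
proof -
  interpret Metric_space G \<rho> using polish by (simp add: polish_metric_space_def)
  have complete: "mcomplete" and sep: "separable_space mtopology"
    using polish by (auto simp: polish_metric_space_def)
  have space_\<mu>: "space \<mu> = G" and sets_\<mu>: "sets \<mu> = sigma_sets G {U. openin mtopology U}"
    using borel by (auto simp: borel_measure_def borel_sets_def)
  have open_\<mu>: "U \<in> sets \<mu>" if "openin mtopology U" for U
    using that by (simp add: sets_\<mu> sigma_sets.Basic)
  obtain C where C: "countable C" "C \<subseteq> G" "mtopology closure_of C = G"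
    using sep by (auto simp: separable_space_def)
  then have "C \<noteq> {}" using ne by auto
  define c where "c = from_nat_into C"
  have range_c: "range c = C" unfolding c_def using C \<open>C \<noteq> {}\<close> by simp
  then have c: "c i \<in> G" for i using C by auto
  have dense: "\<exists>i. \<rho> (c i) x < e" if "x \<in> G" "0 < e" for x e
  proof -
    have "x \<in> mtopology closure_of C" using C(3) that by simp
    then have "\<exists>y\<in>C. \<rho> x y < e" using that by (auto simp: metric_closure_of)
    then show ?thesis using range_c by (metis commute imageE)
  qed
  define near where "near x i k \<longleftrightarrow> \<rho> (c i) x < 1 / real (Suc k)" for x i k
  define f where "f x = ternary (\<lambda>n. near x (fst (prod_decode n)) (snd (prod_decode n)))" for x
  have digit: "ternary_digit (prod_encode (i, k)) (f x) \<longleftrightarrow> near x i k" for x i k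
    by (simp add: f_def ternary_digit_ternary)
  have ball: "{x \<in> G. near x i k} = mball (c i) (1 / real (Suc k))" for i k
    using c by (auto simp: near_def)
  have f_meas: "f \<in> borel_measurable \<mu>" unfolding f_def
  proof (rule ternary_measurable)
    fix n
    have "{x \<in> space \<mu>. near x (fst (prod_decode n)) (snd (prod_decode n))} \<in> sets \<mu>"
      unfolding space_\<mu> ball by (intro open_\<mu> openin_mball)
    then show "Measurable.pred \<mu> (\<lambda>x. near x (fst (prod_decode n)) (snd (prod_decode n)))"
      by (simp add: pred_def)
  qed
  have f_inj: "inj_on f G"
  proof (rule inj_onI, rule ccontr)
    fix x y assume xy: "x \<in> G" "y \<in> G" "f x = f y" "x \<noteq> y"
    have same: "near x i k \<longleftrightarrow> near y i k" for i k using digit[of i k x] digit[of i k y] xy by simp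
    have "0 < \<rho> x y / 2" using xy by simp
    then obtain k where k: "1 / real (Suc k) < \<rho> x y / 2" by (rule reciprocal_Suc_less)
    obtain i where "near x i k" using dense[OF xy(1)] by (force simp: near_def)
    then have "\<rho> (c i) x < 1 / real (Suc k)" "\<rho> (c i) y < 1 / real (Suc k)"
      using same by (auto simp: near_def)
    then show False using triangle''[OF xy(1) c[of i] xy(2)] k by argo
  qed
  have image: "f ` G = {y \<in> range ternary. coherent_balls \<rho> c (\<lambda>i k. ternary_digit (prod_encode (i, k)) y)}"
  proof (intro equalityI subsetI)
    fix y assume "y \<in> f ` G"
    then obtain x where x: "x \<in> G" "y = f x" by blast
    have "coherent_balls \<rho> c (\<lambda>i k. ternary_digit (prod_encode (i, k)) y)"
      unfolding x(2) digit near_def by (rule coherent_balls_of_point[OF c dense x(1)])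
    then show "y \<in> {y \<in> range ternary. coherent_balls \<rho> c (\<lambda>i k. ternary_digit (prod_encode (i, k)) y)}"
      using x(2) by (auto simp: f_def)
  next
    fix y assume "y \<in> {y \<in> range ternary. coherent_balls \<rho> c (\<lambda>i k. ternary_digit (prod_encode (i, k)) y)}"
    then obtain b where b: "y = ternary b" "coherent_balls \<rho> c (\<lambda>i k. b (prod_encode (i, k)))"
      by (auto simp: ternary_digit_ternary)
    obtain x where x: "x \<in> G" "\<And>i k. b (prod_encode (i, k)) \<longleftrightarrow> \<rho> (c i) x < 1 / real (Suc k)"
      using point_of_coherent_balls[OF complete c b(2)] by blast
    have "b = (\<lambda>n. near x (fst (prod_decode n)) (snd (prod_decode n)))"
    proof
      fix n show "b n = near x (fst (prod_decode n)) (snd (prod_decode n))"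
        using x(2)[of "fst (prod_decode n)" "snd (prod_decode n)"] by (simp add: near_def)
    qed
    then have "f x = y" unfolding f_def b(1) by simp
    then show "y \<in> f ` G" using x(1) by blast
  qed
  have image_borel: "f ` G \<in> sets borel"
  proof -
    have "Measurable.pred borel (\<lambda>y. coherent_balls \<rho> c (\<lambda>i k. ternary_digit (prod_encode (i, k)) y))"
      unfolding coherent_balls_def by measurable
    moreover have "f ` G = range ternary \<inter> {y \<in> space borel. coherent_balls \<rho> c (\<lambda>i k. ternary_digit (prod_encode (i, k)) y)}"
      unfolding image by auto
    ultimately show ?thesis using range_ternary_borel by simp
  qed
  \<comment> \<open>Open sets are countable unions of the coded balls, and a ball corresponds to fixing one digit.\<close>
  have open_image: "f ` U \<in> sets borel" if U: "openin mtopology U" for U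
  proof -
    define J where "J = {(i, k). mball (c i) (1 / real (Suc k)) \<subseteq> U}"
    have UG: "U \<subseteq> G" using openin_subset[OF U] by simp
    have "U = (\<Union>(i, k)\<in>J. mball (c i) (1 / real (Suc k)))"
    proof (intro equalityI subsetI)
      fix x assume x: "x \<in> U"
      then obtain r where r: "0 < r" "mball x r \<subseteq> U" using U by (auto simp: openin_mtopology)
      then obtain k where k: "1 / real (Suc k) < r / 2" using reciprocal_Suc_less[of "r / 2"] by auto
      have xG: "x \<in> G" using x UG by blast
      obtain i where i: "\<rho> (c i) x < 1 / real (Suc k)" using dense[OF xG] by force
      have "mball (c i) (1 / real (Suc k)) \<subseteq> mball x r"
        by (rule mball_subset) (use i k xG in argo)+
      then have "(i, k) \<in> J" using r by (auto simp: J_def)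
      then show "x \<in> (\<Union>(i, k)\<in>J. mball (c i) (1 / real (Suc k)))" using i c xG by force
    qed (auto simp: J_def)
    then have "f ` U = (\<Union>(i, k)\<in>J. f ` mball (c i) (1 / real (Suc k)))" by blast
    also have "\<dots> = (\<Union>(i, k)\<in>J. f ` G \<inter> {y \<in> space borel. ternary_digit (prod_encode (i, k)) y})"
    proof -
      have "f ` mball (c i) (1 / real (Suc k)) = f ` G \<inter> {y \<in> space borel. ternary_digit (prod_encode (i, k)) y}" for i k
        unfolding ball[symmetric] by (auto simp: digit)
      then show ?thesis by simp
    qed
    also have "\<dots> \<in> sets borel" using image_borel by (auto intro!: sets.countable_UN')
    finally show ?thesis .
  qed
  have opens: "{U. openin mtopology U} \<subseteq> Pow G" using openin_subset[of mtopology] by fastforce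
  have "f ` A \<in> sets borel" if "A \<in> sets \<mu>" for A
    using that unfolding sets_\<mu>
    by (rule image_sigma_sets_inj[where \<Omega> = G, rotated -1])
       (use opens f_inj image_borel open_image in auto)
  moreover have "emeasure lborel (f ` G) = 0"
    using emeasure_mono[of "f ` G" "range ternary" lborel] range_ternary_borel range_ternary_null image by auto
  moreover have "f ` G \<subseteq> {0..1/2}" using ternary_bounds by (auto simp: f_def)
  ultimately show ?thesis using that f_meas f_inj by blast
qed

section \<open>Atomless distributions on the real line\<close>

locale atomless_distribution = real_distribution +
  assumes atomless: "measure M {x} = 0"
begin

lemma cdf_continuous: "continuous_on A (cdf M)"
  by (intro continuous_at_imp_continuous_on ballI) (simp add: isCont_cdf atomless)

lemma cdf_measurable [measurable]: "cdf M \<in> borel_measurable borel"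
  by (rule borel_measurable_continuous_onI[OF cdf_continuous])

lemma cdf_surj:
  assumes "0 < u" "u < 1" obtains t where "cdf M t = u"
proof -
  have "eventually (\<lambda>x. cdf M x < u) at_bot"
    using cdf_lim_at_bot assms(1) by (rule order_tendstoD(2))
  then obtain a where a: "\<And>x. x \<le> a \<Longrightarrow> cdf M x < u" by (auto simp: eventually_at_bot_linorder)
  have "eventually (\<lambda>x. u < cdf M x) at_top"
    using cdf_lim_at_top_prob assms(2) by (rule order_tendstoD(1))
  then obtain b where b: "\<And>x. x \<ge> b \<Longrightarrow> u < cdf M x" by (auto simp: eventually_at_top_linorder)
  have "a \<le> max a b" "cdf M a \<le> u" "u \<le> cdf M (max a b)"
    using a[of a] b[of "max a b"] by auto
  then obtain t where "cdf M t = u"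
    using IVT'[of "cdf M" a u "max a b"] cdf_continuous by blast
  then show ?thesis using that by blast
qed

text \<open>
  By continuity the level set is a closed half-line, and its end point is again mapped to \<open>u\<close>.
\<close>

lemma cdf_level:
  assumes "0 < u" "u < 1" shows "measure M {y. cdf M y \<le> u} = u"
proof -
  let ?S = "{y. cdf M y \<le> u}"
  obtain t0 where t0: "cdf M t0 = u" using cdf_surj assms .
  have "eventually (\<lambda>x. u < cdf M x) at_top"
    using cdf_lim_at_top_prob assms(2) by (rule order_tendstoD(1))
  then obtain b where b: "\<And>x. x \<ge> b \<Longrightarrow> u < cdf M x" by (auto simp: eventually_at_top_linorder)
  have bdd: "bdd_above ?S" using b by (intro bdd_aboveI[of _ b]) (metis linorder_le_cases mem_Collect_eq not_le)
  have ne: "?S \<noteq> {}" using t0 by auto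
  have "closed ?S" using cdf_continuous[of UNIV] by (intro closed_Collect_le) auto
  then have Sup: "Sup ?S \<in> ?S" using ne bdd by (rule closed_contains_Sup[rotated 2])
  have "?S = {..Sup ?S}"
  proof (intro equalityI subsetI)
    fix y assume "y \<in> ?S" then show "y \<in> {..Sup ?S}" using cSup_upper[OF _ bdd] by auto
  next
    fix y assume "y \<in> {..Sup ?S}" then show "y \<in> ?S" using Sup cdf_nondecreasing[of y "Sup ?S"] by auto
  qed
  then have "measure M ?S = cdf M (Sup ?S)" unfolding cdf_def by simp
  moreover have "t0 \<le> Sup ?S" using t0 by (intro cSup_upper[OF _ bdd]) auto
  then have "u \<le> cdf M (Sup ?S)" using cdf_nondecreasing t0 by blast
  ultimately show ?thesis using Sup by auto
qed

lemma distr_cdf: "distr M borel (cdf M) = uniform_measure lborel {0..1}"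
proof (rule cdf_unique)
  interpret U: prob_space "uniform_measure lborel {0..1::real}"
    by (rule prob_space_uniform_measure) auto
  show "real_distribution (uniform_measure lborel {0..1::real})" by standard simp
  interpret D: real_distribution "distr M borel (cdf M)" by (rule real_distribution_distr, rule measurable_finite_borel) measurable
  show "real_distribution (distr M borel (cdf M))" by (fact D.real_distribution_axioms)
  show "cdf (distr M borel (cdf M)) = cdf (uniform_measure lborel {0..1})"
  proof
    fix u
    have 1: "cdf (distr M borel (cdf M)) u = measure M {y. cdf M y \<le> u}"
      unfolding cdf_def2[of "distr M borel (cdf M)"] by (subst measure_distr) (auto simp: vimage_def)
    have 2: "cdf (uniform_measure lborel {0..1}) u = measure lborel ({0..1} \<inter> {..u})"
      unfolding cdf_def by (subst measure_uniform_measure) auto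
    consider "u \<le> 0" | "0 < u" "u < 1" | "1 \<le> u" by linarith
    then show "cdf (distr M borel (cdf M)) u = cdf (uniform_measure lborel {0..1}) u"
    proof cases
      case 1
      have "measure M {y. cdf M y \<le> u} \<le> e" if "0 < e" "e < 1" for e
      proof -
        have "measure M {y. cdf M y \<le> u} \<le> measure M {y. cdf M y \<le> e}"
          using \<open>u \<le> 0\<close> that by (intro finite_measure_mono) auto
        then show ?thesis using cdf_level[OF that] by simp
      qed
      then have "measure M {y. cdf M y \<le> u} \<le> 0"
        by (intro dense_ge_bounded[of 0 1]) auto
      then have "measure M {y. cdf M y \<le> u} = 0" using measure_nonneg[of M] by (simp add: order_antisym)
      moreover have "{0..1} \<inter> {..u} \<subseteq> {0}" using 1 by auto
      then have "emeasure lborel ({0..1} \<inter> {..u}) \<le> emeasure lborel {0 :: real}"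
        by (intro emeasure_mono) auto
      then have "measure lborel ({0..1} \<inter> {..u}) = 0" by (simp add: measure_def)
      ultimately show ?thesis using \<open>cdf (distr M borel (cdf M)) u = _\<close> 2 by simp
    next
      case 2
      then have "{0..1} \<inter> {..u} = {0..u}" by auto
      then show ?thesis using 1 \<open>cdf (uniform_measure lborel {0..1}) u = _\<close> cdf_level[OF 2] 2 by simp
    next
      case 3
      then have "{0..1} \<inter> {..u} = {0..1}" "{y. cdf M y \<le> u} = space M"
        using cdf_bounded_prob by (auto intro: order_trans)
      then show ?thesis using 1 2 prob_space by simp
    qed
  qed
qed

lemma emeasure_cdf_vimage:
  assumes "A \<in> sets borel" shows "emeasure M {x. cdf M x \<in> A} = emeasure lborel ({0..1} \<inter> A)"
proof -
  have "emeasure M {x. cdf M x \<in> A} = emeasure (distr M borel (cdf M)) A"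
    using assms by (subst emeasure_distr) (auto simp: vimage_def)
  also have "\<dots> = emeasure lborel ({0..1} \<inter> A)"
    unfolding distr_cdf using assms by (subst emeasure_uniform_measure) (auto simp: divide_ennreal_def)
  finally show ?thesis .
qed

end

text \<open>
  An arbitrary choice of preimages under a monotone function is strictly monotone, hence Borel.
  The default value outside \<open>I\<close> makes it a total function.
\<close>

lemma mono_section_measurable:
  fixes F :: "real \<Rightarrow> real"
  assumes "mono F" "I \<in> sets borel" "\<And>u. u \<in> I \<Longrightarrow> F (q u) = u"
  shows "(\<lambda>u. if u \<in> I then q u else 0) \<in> borel_measurable borel"
proof -
  have "q \<in> borel_measurable (restrict_space borel I)"
    by (rule borel_measurable_mono_on_fnc, rule mono_onI)
       (metis assms(1,3) monoD linorder_le_cases order_antisym)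
  then show ?thesis using assms(2) by (subst (asm) measurable_restrict_space_iff[where c=0]) auto
qed

text \<open>
  Almost everywhere \<open>g\<close> is the distribution function \<open>F\<close>.  Two points share a value of \<open>F\<close> only if
  \<open>F\<close> takes that value at a rational number between them, so outside the null set \<open>V\<close> of values \<open>F\<close>
  is injective.  Points of \<open>S\<close> with value in \<open>V\<close> are left in place: since \<open>S\<close> is contained in \<open>V\<close>, they
  cannot meet a value outside \<open>V\<close>, and since \<open>S\<close> is null, they do not contribute to the measure.
\<close>

lemma (in atomless_distribution) injection_into_interval:
  assumes S: "S \<in> sets borel" "S \<subseteq> {0..<1}" "emeasure lborel S = 0"
  obtains g :: "real \<Rightarrow> real" where "g \<in> borel_measurable borel" "inj_on g S" "g ` S \<subseteq> {0..<1}"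
    "\<And>A. A \<in> sets borel \<Longrightarrow> A \<subseteq> S \<Longrightarrow> g ` A \<in> sets borel \<and> emeasure lborel (g ` A) = emeasure M A"
proof -
  define F where "F = cdf M"
  have F_mono: "mono F" unfolding F_def by (rule monoI) (rule cdf_nondecreasing)
  have [measurable]: "F \<in> borel_measurable borel" unfolding F_def by simp
  define V where "V = S \<union> {0, 1} \<union> F ` \<rat>"
  have "countable ({0, 1} \<union> F ` \<rat>)" by (simp add: countable_rat)
  then have "{0, 1} \<union> F ` \<rat> \<in> null_sets lborel" by (rule countable_imp_null_set_lborel)
  moreover have "S \<in> null_sets lborel" using S by (simp add: null_sets_def)
  ultimately have V: "V \<in> null_sets lborel" unfolding V_def Un_assoc by (rule null_sets.Un[rotated])
  have V_borel [measurable]: "V \<in> sets borel" using V by (simp add: null_sets_def)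
  have "\<exists>t. F t = u" if "u \<in> {0<..<1}" for u
    using cdf_surj[of u] that unfolding F_def by auto
  then obtain q0 where q0: "\<And>u. u \<in> {0<..<1} \<Longrightarrow> F (q0 u) = u" by metis
  define q where "q u = (if u \<in> {0<..<1} then q0 u else 0)" for u
  have q: "F (q u) = u" if "0 < u" "u < 1" for u using that q0 by (simp add: q_def)
  have [measurable]: "q \<in> borel_measurable borel" unfolding q_def
    by (rule mono_section_measurable[OF F_mono _ q0]) auto
  have F_range: "0 \<le> F x" "F x \<le> 1" for x unfolding F_def using cdf_nonneg cdf_bounded_prob by auto
  have F_off_V: "0 < F x" "F x < 1" if "F x \<notin> V" for x
    using F_range[of x] that by (auto simp: V_def less_le)
  have F_inj: "x = y" if "F x \<notin> V" "F x = F y" for x y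
  proof (rule ccontr)
    have *: False if "x < y" "F x \<notin> V" "F x = F y" for x y
    proof -
      obtain r where "x < of_rat r" "of_rat r < y" using of_rat_dense[OF \<open>x < y\<close>] by blast
      then have "F x \<le> F (of_rat r)" "F (of_rat r) \<le> F y" using F_mono by (auto simp: monoD)
      then have "F x = F (of_rat r)" using that by simp
      then show False using that(2) by (auto simp: V_def)
    qed
    assume "x \<noteq> y"
    then consider "x < y" | "y < x" by linarith
    then show False
    proof cases
      case 1 then show False by (rule *) (fact that)+
    next
      case 2 then show False by (rule *) (use that in simp_all)
    qed
  qed
  define g where "g x = (if F x \<in> V then x else F x)" for x
  have "g \<in> borel_measurable borel" unfolding g_def by measurable
  moreover have "inj_on g S"
  proof (rule inj_onI)
    fix x y assume xy: "x \<in> S" "y \<in> S" "g x = g y"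
    have "x \<in> V" "y \<in> V" using xy by (auto simp: V_def)
    then consider "F x \<in> V" "F y \<in> V" | "F x \<notin> V" "F y \<notin> V"
      using xy(3) unfolding g_def by metis
    then show "x = y"
    proof cases
      case 1 then show ?thesis using xy(3) by (simp add: g_def)
    next
      case 2
      then have "F x = F y" using xy(3) by (simp add: g_def)
      with 2(1) show ?thesis by (rule F_inj)
    qed
  qed
  moreover have "g ` S \<subseteq> {0..<1}" using S(2) F_off_V by (auto simp: g_def less_imp_le)
  moreover have "g ` A \<in> sets borel \<and> emeasure lborel (g ` A) = emeasure M A"
    if A [measurable]: "A \<in> sets borel" and "A \<subseteq> S" for A
  proof -
    \<comment> \<open>The image of \<open>A\<close> is \<open>B\<close>, which stays in place, together with \<open>D\<close>, the values of \<open>F\<close> outside \<open>V\<close>.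
      Describing \<open>D\<close> by the section \<open>q\<close> of \<open>F\<close> shows that it is Borel.\<close>
    define B where "B = A \<inter> {x \<in> space borel. F x \<in> V}"
    define D where "D = {u \<in> space borel. 0 < u \<and> u < 1 \<and> u \<notin> V \<and> q u \<in> A}"
    have [measurable]: "B \<in> sets borel" "D \<in> sets borel" unfolding B_def D_def by measurable
    have FV: "{x. F x \<in> V} \<in> null_sets M"
    proof -
      have "emeasure lborel ({0..1} \<inter> V) = 0"
        using null_set_Int1[OF V, of "{0..1}"] by (auto simp: null_sets_def Int_commute)
      moreover have "{x \<in> space borel. F x \<in> V} \<in> sets borel" by measurable
      ultimately show ?thesis using emeasure_cdf_vimage[OF V_borel] by (auto simp: null_sets_def F_def)
    qed
    have "emeasure lborel B \<le> emeasure lborel S"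
      by (rule emeasure_mono) (use \<open>A \<subseteq> S\<close> S in \<open>auto simp: B_def\<close>)
    then have B: "B \<in> null_sets lborel" using S(3) by (auto simp: null_sets_def)
    have D: "{x. F x \<in> D} = A - {x. F x \<in> V}"
    proof (intro equalityI subsetI)
      fix x assume "x \<in> {x. F x \<in> D}"
      then have x: "0 < F x" "F x < 1" "F x \<notin> V" "q (F x) \<in> A" by (auto simp: D_def)
      have "x = q (F x)" using F_inj[OF x(3)] q[OF x(1,2)] by simp
      then show "x \<in> A - {x. F x \<in> V}" using x by auto
    next
      fix x assume x: "x \<in> A - {x. F x \<in> V}"
      have "x = q (F x)" using F_inj[of x "q (F x)"] q[OF F_off_V[of x]] x by auto
      then show "x \<in> {x. F x \<in> D}" using x F_off_V[of x] by (auto simp: D_def)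
    qed
    have "g ` A = F ` {x. F x \<in> D} \<union> B" unfolding D by (auto simp: g_def B_def)
    also have "F ` {x. F x \<in> D} = D"
    proof
      show "D \<subseteq> F ` {x. F x \<in> D}"
      proof
        fix u assume u: "u \<in> D"
        then have "F (q u) = u" by (intro q) (auto simp: D_def)
        then show "u \<in> F ` {x. F x \<in> D}" using u by (intro image_eqI[of _ _ "q u"]) auto
      qed
    qed auto
    finally have image: "g ` A = D \<union> B" .
    have "emeasure lborel (g ` A) = emeasure lborel D"
      unfolding image using B by (intro emeasure_Un_null_set) auto
    also have "\<dots> = emeasure lborel ({0..1} \<inter> D)"
      by (rule arg_cong[where f = "emeasure lborel"]) (auto simp: D_def)
    also have "\<dots> = emeasure M (A - {x. F x \<in> V})"
      using emeasure_cdf_vimage[of D] unfolding F_def[symmetric] D by simp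
    also have "\<dots> = emeasure M A" by (rule emeasure_Diff_null_set[OF FV]) simp
    finally show ?thesis unfolding image by simp
  qed
  ultimately show ?thesis using that by blast
qed

section \<open>Absorbing a null set into the unit interval\<close>

lemma atomless_uniform_measure:
  fixes L :: "real set"
  assumes L: "L \<in> sets borel" "emeasure lborel L \<noteq> 0" "emeasure lborel L \<noteq> \<infinity>"
  shows "atomless_distribution (uniform_measure lborel L)"
proof -
  interpret prob_space "uniform_measure lborel L" using L by (intro prob_space_uniform_measure) auto
  show ?thesis
  proof
    fix x :: real
    have "emeasure lborel (L \<inter> {x}) \<le> emeasure lborel {x}" using L by (intro emeasure_mono) auto
    then have "emeasure (uniform_measure lborel L) {x} = 0" using L
      by (subst emeasure_uniform_measure) auto
    then show "measure (uniform_measure lborel L) {x} = 0" by (simp add: measure_def)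
  qed simp
qed

lemma compact_subset_positive:
  fixes R :: "real set"
  assumes R: "R \<in> sets borel" "emeasure lborel R \<noteq> 0" "emeasure lborel R \<noteq> \<infinity>"
  obtains L where "compact L" "L \<subseteq> R" "emeasure lborel L \<noteq> 0" "emeasure lborel L \<noteq> \<infinity>"
proof -
  interpret atomless_distribution "uniform_measure lborel R" by (rule atomless_uniform_measure[OF R])
  have R1: "emeasure (uniform_measure lborel R) R = 1"
    using R by (intro emeasure_uniform_measure_1) auto
  also have "emeasure (uniform_measure lborel R) R =
      (SUP K \<in> {K. K \<subseteq> R \<and> compact K}. emeasure (uniform_measure lborel R) K)"
    by (rule inner_regular) (use R in \<open>simp_all only: emeasure_space_1 events_eq_borel\<close>, simp)
  finally have "0 < (SUP K \<in> {K. K \<subseteq> R \<and> compact K}. emeasure (uniform_measure lborel R) K)" by simp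
  then obtain L where L: "L \<subseteq> R" "compact L" "0 < emeasure (uniform_measure lborel R) L"
    by (auto simp: less_SUP_iff)
  have Lb: "L \<in> sets borel" using L(2) by (simp add: borel_compact)
  have "R \<inter> L = L" using L by auto
  then have "emeasure lborel L \<noteq> 0" using L(3) R Lb by (auto simp: emeasure_uniform_measure)
  moreover have "emeasure lborel L \<noteq> \<infinity>"
    using emeasure_mono[OF L(1), of lborel] R by (auto simp: top_unique)
  ultimately show ?thesis using that L by blast
qed

text \<open>
  Take a compact set \<open>L\<close> of positive measure in \<open>R\<close> and let \<open>j\<close> choose preimages in \<open>L\<close> under the
  distribution function \<open>F\<close> of the uniform measure on \<open>L\<close>.  Since \<open>F\<close> maps that measure to Lebesgue
  measure, \<open>j\<close> preserves null sets.  Compactness guarantees that each value of \<open>F\<close>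
  is taken on \<open>L\<close> itself and not merely almost everywhere, so that \<open>j\<close> has all its values in \<open>R\<close>.
\<close>

lemma null_preserving_injection:
  fixes R :: "real set"
  assumes R: "R \<in> sets borel" "emeasure lborel R \<noteq> 0" "emeasure lborel R \<noteq> \<infinity>"
  obtains j :: "real \<Rightarrow> real" where "j \<in> borel_measurable borel" "inj_on j {0..<1}" "j ` {0..<1} \<subseteq> R"
    "\<And>A. A \<in> null_sets lborel \<Longrightarrow> A \<subseteq> {0..<1} \<Longrightarrow> j ` A \<in> null_sets lborel"
    "\<And>A. A \<in> sets borel \<Longrightarrow> A \<subseteq> {0..<1} \<Longrightarrow> j ` A \<in> sets borel"
proof -
  obtain L where L: "compact L" "L \<subseteq> R" "emeasure lborel L \<noteq> 0" "emeasure lborel L \<noteq> \<infinity>"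
    using compact_subset_positive[OF R] .
  have Lb [measurable]: "L \<in> sets borel" using L(1) by (simp add: borel_compact)
  interpret atomless_distribution "uniform_measure lborel L" by (rule atomless_uniform_measure[OF Lb L(3,4)])
  define F where "F = cdf (uniform_measure lborel L)"
  have F_mono: "mono F" unfolding F_def by (rule monoI) (rule cdf_nondecreasing)
  have [measurable]: "F \<in> borel_measurable borel" unfolding F_def by (rule cdf_measurable)
  have F_cont: "continuous_on A F" for A unfolding F_def by (rule cdf_continuous)
  have F_nonneg: "0 \<le> F x" for x unfolding F_def by (rule cdf_nonneg)
  have F_gap: "F x = F y" if "x \<le> y" "{x<..y} \<inter> L = {}" for x y
  proof (cases "x = y")
    case False
    then have "F y - F x = measure (uniform_measure lborel L) {x<..y}"
      unfolding F_def using that by (intro cdf_diff_eq) auto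
    also have "\<dots> = 0" using that L by (simp add: measure_uniform_measure Int_commute)
    finally show ?thesis by simp
  qed simp
  have L_ne: "L \<noteq> {}" using L by auto
  have L_bdd: "bdd_below L" "bdd_above L" using compact_imp_bounded[OF L(1)] by (auto intro: bounded_imp_bdd_below bounded_imp_bdd_above)
  have L_Inf: "Inf L \<in> L" using L_ne L_bdd(1) compact_imp_closed[OF L(1)] by (rule closed_contains_Inf)
  have F_Inf: "F (Inf L) = 0"
  proof -
    have "L \<inter> {..Inf L} = L \<inter> {Inf L}" using cInf_lower[OF _ L_bdd(1)] by force
    then have "measure (uniform_measure lborel L) {..Inf L} = measure (uniform_measure lborel L) {Inf L}"
      using L by (simp add: measure_uniform_measure)
    then show ?thesis using atomless by (simp add: F_def cdf_def)
  qed
  have "\<exists>x\<in>L. F x = u" if u: "0 \<le> u" "u < 1" for u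
  proof (cases "u = 0")
    case True then show ?thesis using F_Inf L_Inf by blast
  next
    case False
    then obtain y where y: "F y = u" using cdf_surj[of u] u unfolding F_def by auto
    \<comment> \<open>Slide down from \<open>y\<close> to the last point of \<open>L\<close> that precedes it; no mass is lost.\<close>
    have "closed (L \<inter> {..y})" using L(1) by (intro closed_Int compact_imp_closed) auto
    moreover have "L \<inter> {..y} \<noteq> {}"
    proof
      assume "L \<inter> {..y} = {}"
      then have "y < Inf L" using L_Inf by force
      then show False using monoD[OF F_mono, of y "Inf L"] F_Inf y u False by auto
    qed
    moreover have bdd: "bdd_above (L \<inter> {..y})" by auto
    ultimately have mem: "Sup (L \<inter> {..y}) \<in> L \<inter> {..y}" by (intro closed_contains_Sup)
    have "{Sup (L \<inter> {..y})<..y} \<inter> L = {}" using cSup_upper[OF _ bdd] by force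
    then have "F (Sup (L \<inter> {..y})) = F y" using mem by (intro F_gap) auto
    then show ?thesis using mem y by auto
  qed
  then obtain q0 where q0: "\<And>u. u \<in> {0..<1} \<Longrightarrow> q0 u \<in> L \<and> F (q0 u) = u"
    by (metis atLeastLessThan_iff)
  define j where "j u = (if u \<in> {0..<1} then q0 u else 0)" for u
  have j: "j u \<in> L" "F (j u) = u" if "u \<in> {0..<1}" for u using that q0 by (auto simp: j_def)
  have j_meas [measurable]: "j \<in> borel_measurable borel" unfolding j_def
    by (rule mono_section_measurable[OF F_mono]) (use q0 in auto)
  have image: "j ` A = {x \<in> space borel. F x \<in> A \<and> j (F x) = x}" if "A \<subseteq> {0..<1}" for A
  proof (intro equalityI subsetI)
    fix x assume "x \<in> j ` A"
    then obtain u where "u \<in> A" "x = j u" by blast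
    then show "x \<in> {x \<in> space borel. F x \<in> A \<and> j (F x) = x}" using j(2)[of u] that by auto
  next
    fix x assume "x \<in> {x \<in> space borel. F x \<in> A \<and> j (F x) = x}"
    then show "x \<in> j ` A" by (intro image_eqI[of _ _ "F x"]) auto
  qed
  have borel: "j ` A \<in> sets borel" if [measurable]: "A \<in> sets borel" and "A \<subseteq> {0..<1}" for A
    unfolding image[OF that(2)] by measurable
  have null: "j ` A \<in> null_sets lborel" if A: "A \<in> null_sets lborel" "A \<subseteq> {0..<1}" for A
  proof -
    have Ab [measurable]: "A \<in> sets borel" using A by (simp add: null_sets_def)
    have FA: "{x \<in> space borel. F x \<in> A} \<in> sets borel" by measurable
    have "emeasure lborel ({0..1} \<inter> A) = 0"
      using null_set_Int1[OF A(1), of "{0..1}"] by (auto simp: null_sets_def Int_commute)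
    then have "emeasure (uniform_measure lborel L) {x. F x \<in> A} = 0"
      using emeasure_cdf_vimage[OF Ab] by (simp add: F_def)
    then have "emeasure lborel (L \<inter> {x. F x \<in> A}) = 0"
      using FA L by (subst (asm) emeasure_uniform_measure) (auto simp: ennreal_divide_eq_0_iff)
    moreover have "j ` A \<subseteq> L \<inter> {x. F x \<in> A}" using j A(2) by auto
    ultimately have "emeasure lborel (j ` A) = 0"
      using FA emeasure_mono[of "j ` A" "L \<inter> {x. F x \<in> A}" lborel] by auto
    then show ?thesis using borel[OF Ab A(2)] by (simp add: null_sets_def)
  qed
  have "inj_on j {0..<1}" by (rule inj_on_inverseI[of _ F]) (rule j(2))
  then show ?thesis using that[of j] j_meas j(1) L(2) null borel by blast
qed

text \<open>
  Let \<open>E\<close> be the union of the iterated images of \<open>N = [0, 1) - R\<close> under a null-preserving injection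
  \<open>j\<close> into \<open>R\<close>.  Then \<open>E\<close> is null and \<open>j\<close> maps \<open>E\<close> onto \<open>E - N\<close>, so \<open>j\<close> on \<open>E\<close> and the identity
  elsewhere combine to a bijection from \<open>[0, 1)\<close> onto \<open>[0, 1) - N = R\<close>.
\<close>

lemma interval_full_measure_isomorphism:
  fixes R :: "real set"
  assumes R: "R \<in> sets borel" "R \<subseteq> {0..<1}" "emeasure lborel R = 1"
  obtains b :: "real \<Rightarrow> real" where "b \<in> borel_measurable borel" "bij_betw b {0..<1} R"
    "\<And>A. A \<in> sets borel \<Longrightarrow> A \<subseteq> {0..<1} \<Longrightarrow> b ` A \<in> sets borel \<and> emeasure lborel (b ` A) = emeasure lborel A"
proof -
  obtain j :: "real \<Rightarrow> real" where j: "j \<in> borel_measurable borel" "inj_on j {0..<1}" "j ` {0..<1} \<subseteq> R"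
    and j_null: "\<And>A. A \<in> null_sets lborel \<Longrightarrow> A \<subseteq> {0..<1} \<Longrightarrow> j ` A \<in> null_sets lborel"
    and j_borel: "\<And>A. A \<in> sets borel \<Longrightarrow> A \<subseteq> {0..<1} \<Longrightarrow> j ` A \<in> sets borel"
    using null_preserving_injection[of R] R by auto
  note j(1)[measurable]
  define N where "N = {0..<1} - R"
  define E where "E = (\<Union>n. (j ^^ n) ` N)"
  have N: "N \<in> null_sets lborel"
    using emeasure_Diff[of lborel R "{0..<1}"] R by (auto simp: N_def null_sets_def)
  have iter: "(j ^^ n) ` N \<in> null_sets lborel \<and> (j ^^ n) ` N \<subseteq> {0..<1}" for n
  proof (induction n)
    case 0 then show ?case using N by (auto simp: N_def)
  next
    case (Suc n)
    have "(j ^^ Suc n) ` N = j ` (j ^^ n) ` N" by (simp add: image_comp)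
    then show ?case using Suc j_null[of "(j ^^ n) ` N"] j(3) R(2) by (metis image_mono order_trans)
  qed
  have E_null: "E \<in> null_sets lborel" and E_sub: "E \<subseteq> {0..<1}" unfolding E_def using iter by auto
  have E [measurable]: "E \<in> sets borel" using E_null by (simp add: null_sets_def)
  have NE: "N \<subseteq> E" unfolding E_def using UN_upper[of 0 UNIV "\<lambda>n. (j ^^ n) ` N"] by simp
  have jE: "j ` E = E - N"
  proof
    have "j ((j ^^ n) x) = (j ^^ Suc n) x" for n x by simp
    then have "j ` E \<subseteq> E" unfolding E_def by blast
    then show "j ` E \<subseteq> E - N" using j(3) E_sub by (auto simp: N_def)
    show "E - N \<subseteq> j ` E"
    proof
      fix r assume "r \<in> E - N"
      then obtain n x where nx: "x \<in> N" "r = (j ^^ n) x" "r \<notin> N" by (auto simp: E_def)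
      then obtain m where "n = Suc m" by (cases n) auto
      then show "r \<in> j ` E" using nx by (auto simp: E_def)
    qed
  qed
  define b where "b u = (if u \<in> E then j u else u)" for u
  have image: "b ` A = (A - E) \<union> j ` (A \<inter> E)" for A by (auto simp: b_def)
  have "b \<in> borel_measurable borel" unfolding b_def by measurable
  moreover have "bij_betw b {0..<1} R" unfolding bij_betw_def
  proof
    show "inj_on b {0..<1}"
    proof (rule inj_onI)
      fix x y :: real assume xy: "x \<in> {0..<1}" "y \<in> {0..<1}" "b x = b y"
      have "x \<in> E \<longleftrightarrow> b x \<in> E" for x using jE by (auto simp: b_def)
      then have "x \<in> E \<longleftrightarrow> y \<in> E" using xy(3) by metis
      then show "x = y" using xy inj_onD[OF j(2)] by (auto simp: b_def split: if_splits)
    qed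
    have "{0..<1} \<inter> E = E" using E_sub by auto
    then show "b ` {0..<1} = R" unfolding image using jE NE E_sub R(2) by (auto simp: N_def)
  qed
  moreover have "b ` A \<in> sets borel \<and> emeasure lborel (b ` A) = emeasure lborel A"
    if A: "A \<in> sets borel" "A \<subseteq> {0..<1}" for A
  proof -
    have "j ` (A \<inter> E) \<in> null_sets lborel"
      using A E_null by (intro j_null null_set_Int1) auto
    moreover have "emeasure lborel (A - E) = emeasure lborel A"
      using A E_null by (intro emeasure_Diff_null_set) auto
    ultimately show ?thesis unfolding image using A E
      by (auto simp: emeasure_Un_null_set null_sets_def)
  qed
  ultimately show ?thesis using that by blast
qed

text \<open>
  The composition of the three constructions: \<open>a = g \<circ> f\<close> maps \<open>G\<close> onto a set of full measure in
  \<open>[0, 1)\<close>, and the inverse of \<open>b\<close> spreads that set over the whole interval.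
\<close>

lemma isomorphism_with_unit_interval:
  assumes polish: "polish_metric_space G \<rho>" and borel: "borel_measure (Metric_space.mtopology G \<rho>) \<mu>"
    and prob: "prob_space \<mu>" and diffused: "diffused \<mu>"
  obtains \<phi> :: "'a \<Rightarrow> real" where "\<phi> \<in> borel_measurable \<mu>" "bij_betw \<phi> G {0..<1}"
    "\<And>A. A \<in> sets \<mu> \<Longrightarrow> \<phi> ` A \<in> sets borel \<and> emeasure lborel (\<phi> ` A) = emeasure \<mu> A"
proof -
  interpret prob_space \<mu> by fact
  have "Metric_space G \<rho>" using polish by (simp add: polish_metric_space_def)
  then have space_\<mu>: "space \<mu> = G"
    using borel by (simp add: borel_measure_def Metric_space.topspace_mtopology)
  then have "G \<noteq> {}" using not_empty by simp
  then obtain f :: "'a \<Rightarrow> real" where f [measurable]: "f \<in> borel_measurable \<mu>"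
    and f_inj: "inj_on f G" and f_range: "f ` G \<subseteq> {0..1/2}"
    and f_image: "\<And>A. A \<in> sets \<mu> \<Longrightarrow> f ` A \<in> sets borel" and f_null: "emeasure lborel (f ` G) = 0"
    using polish_null_embedding[OF polish borel] by blast
  have G_sets: "G \<in> sets \<mu>" using sets.top[of \<mu>] space_\<mu> by simp
  have singleton: "emeasure \<mu> (f -` {y} \<inter> space \<mu>) = 0" for y
  proof (cases "y \<in> f ` G")
    case True
    then obtain x where "x \<in> G" "y = f x" by blast
    then have "f -` {y} \<inter> space \<mu> = {x}" using f_inj space_\<mu> by (auto dest: inj_onD)
    then show ?thesis using diffused \<open>x \<in> G\<close> space_\<mu> by (simp add: diffused_def)
  next
    case False
    then have "f -` {y} \<inter> space \<mu> = {}" using space_\<mu> by auto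
    then show ?thesis by simp
  qed
  interpret D: real_distribution "distr \<mu> borel f" by (rule real_distribution_distr) measurable
  have "measure (distr \<mu> borel f) {y} = 0" for y
    using singleton[of y] by (subst measure_distr) (auto simp: measure_def)
  then interpret D: atomless_distribution "distr \<mu> borel f" by unfold_locales
  have f_range': "f ` G \<subseteq> {0..<1}" using f_range by force
  obtain g :: "real \<Rightarrow> real" where g [measurable]: "g \<in> borel_measurable borel" and g_inj: "inj_on g (f ` G)"
    and g_range: "g ` f ` G \<subseteq> {0..<1}"
    and g_image: "\<And>A. A \<in> sets borel \<Longrightarrow> A \<subseteq> f ` G \<Longrightarrow>
      g ` A \<in> sets borel \<and> emeasure lborel (g ` A) = emeasure (distr \<mu> borel f) A"
    using D.injection_into_interval[OF f_image[OF G_sets] f_range' f_null] by blast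
  define a where "a x = g (f x)" for x
  have [measurable]: "a \<in> borel_measurable \<mu>" unfolding a_def by measurable
  have a_inj: "inj_on a G" unfolding a_def using comp_inj_on[OF f_inj g_inj] unfolding comp_def .
  have a_image: "a ` A \<in> sets borel \<and> emeasure lborel (a ` A) = emeasure \<mu> A" if A: "A \<in> sets \<mu>" for A
  proof -
    have AG: "A \<subseteq> G" using sets.sets_into_space[OF A] space_\<mu> by simp
    have "f -` (f ` A) \<inter> space \<mu> = A" using AG f_inj space_\<mu> by (auto dest: inj_onD)
    then have "emeasure (distr \<mu> borel f) (f ` A) = emeasure \<mu> A"
      using f_image[OF A] by (simp add: emeasure_distr)
    moreover have "a ` A = g ` f ` A" by (auto simp: a_def)
    ultimately show ?thesis using g_image[of "f ` A"] f_image[OF A] AG by auto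
  qed
  have a_range: "a ` G \<subseteq> {0..<1}" using g_range by (auto simp: a_def)
  have "emeasure lborel (a ` G) = 1" using a_image[OF G_sets] emeasure_space_1 space_\<mu> by simp
  then obtain b :: "real \<Rightarrow> real" where b [measurable]: "b \<in> borel_measurable borel" and b_bij: "bij_betw b {0..<1} (a ` G)"
    and b_image: "\<And>A. A \<in> sets borel \<Longrightarrow> A \<subseteq> {0..<1} \<Longrightarrow>
      b ` A \<in> sets borel \<and> emeasure lborel (b ` A) = emeasure lborel A"
    using interval_full_measure_isomorphism[OF conjunct1[OF a_image[OF G_sets]] a_range] by blast
  define b' where "b' = the_inv_into {0..<1} b"
  have b'_bij: "bij_betw b' (a ` G) {0..<1}" unfolding b'_def by (rule bij_betw_the_inv_into[OF b_bij])
  have b'b: "b' (b u) = u" if "u \<in> {0..<1}" for u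
    unfolding b'_def using b_bij that by (simp add: bij_betw_def the_inv_into_f_f)
  have bb': "b (b' v) = v" if "v \<in> a ` G" for v
    unfolding b'_def using b_bij that by (simp add: bij_betw_def f_the_inv_into_f)
  have b'_range: "b' v \<in> {0..<1}" if "v \<in> a ` G" for v using b'_bij that bij_betwE by blast
  define \<phi> where "\<phi> x = b' (a x)" for x
  have "bij_betw \<phi> G {0..<1}"
    using bij_betw_trans[OF inj_on_imp_bij_betw[OF a_inj] b'_bij] by (simp add: \<phi>_def[abs_def] comp_def)
  moreover have "\<phi> \<in> borel_measurable \<mu>"
  proof (rule measurableI)
    fix A :: "real set" assume "A \<in> sets borel"
    then have "A \<inter> {0..<1} \<in> sets borel" by auto
    then have [measurable]: "b ` (A \<inter> {0..<1}) \<in> sets borel" using b_image by auto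
    have "\<phi> -` A \<inter> space \<mu> = {x \<in> space \<mu>. a x \<in> b ` (A \<inter> {0..<1})}"
    proof (intro equalityI subsetI)
      fix x assume "x \<in> \<phi> -` A \<inter> space \<mu>"
      then have "a x = b (\<phi> x)" "\<phi> x \<in> A \<inter> {0..<1}" "x \<in> space \<mu>"
        using bb'[of "a x"] b'_range[of "a x"] space_\<mu> by (auto simp: \<phi>_def)
      then show "x \<in> {x \<in> space \<mu>. a x \<in> b ` (A \<inter> {0..<1})}" by auto
    next
      fix x assume "x \<in> {x \<in> space \<mu>. a x \<in> b ` (A \<inter> {0..<1})}"
      then show "x \<in> \<phi> -` A \<inter> space \<mu>" using b'b by (auto simp: \<phi>_def)
    qed
    then show "\<phi> -` A \<inter> space \<mu> \<in> sets \<mu>" by simp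
  qed simp
  moreover have "\<phi> ` A \<in> sets borel \<and> emeasure lborel (\<phi> ` A) = emeasure \<mu> A" if A: "A \<in> sets \<mu>" for A
  proof -
    have AG: "A \<subseteq> G" using sets.sets_into_space[OF A] space_\<mu> by simp
    have [measurable]: "a ` A \<in> sets borel" using a_image[OF A] by simp
    have eq: "\<phi> ` A = {u \<in> space borel. 0 \<le> u \<and> u < 1 \<and> b u \<in> a ` A}"
    proof (intro equalityI subsetI)
      fix u assume "u \<in> \<phi> ` A"
      then obtain x where "x \<in> A" "u = b' (a x)" by (auto simp: \<phi>_def)
      then show "u \<in> {u \<in> space borel. 0 \<le> u \<and> u < 1 \<and> b u \<in> a ` A}"
        using bb'[of "a x"] b'_range[of "a x"] AG by auto
    next
      fix u assume u: "u \<in> {u \<in> space borel. 0 \<le> u \<and> u < 1 \<and> b u \<in> a ` A}"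
      then obtain x where "x \<in> A" "b u = a x" by auto
      then have "\<phi> x = u" using b'b[of u] u by (simp add: \<phi>_def)
      then show "u \<in> \<phi> ` A" using \<open>x \<in> A\<close> by blast
    qed
    have borel: "\<phi> ` A \<in> sets borel" unfolding eq by measurable
    have "b ` \<phi> ` A = a ` A"
      unfolding image_image \<phi>_def by (rule image_cong) (use bb' AG in auto)
    moreover have "\<phi> ` A \<subseteq> {0..<1}" unfolding eq by auto
    ultimately have "emeasure lborel (\<phi> ` A) = emeasure lborel (a ` A)"
      using b_image[OF borel] by metis
    then show ?thesis using borel a_image[OF A] by simp
  qed
  ultimately show ?thesis using that by blast
qed

section \<open>The circle\<close>

text \<open>
  A rotation of \<open>[0, 1)\<close> modulo 1 translates the part of \<open>A\<close> below \<open>1 - s\<close> by \<open>s\<close> and the rest by \<open>s - 1\<close>.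
\<close>

lemma emeasure_lborel_rotation:
  assumes A: "A \<in> sets borel" "A \<subseteq> {0..<1::real}" and s: "0 \<le> s" "s < 1"
  shows "(\<lambda>t. frac (s + t)) ` A \<in> sets borel"
    "emeasure lborel ((\<lambda>t. frac (s + t)) ` A) = emeasure lborel A"
proof -
  have shift: "(+) c ` B \<in> sets borel \<and> emeasure lborel ((+) c ` B) = emeasure lborel B"
    if "B \<in> sets borel" for B :: "real set" and c
  proof -
    have eq: "(+) c ` B = (+) (- c) -` B"
    proof (intro equalityI subsetI)
      fix x assume "x \<in> (+) (- c) -` B"
      then show "x \<in> (+) c ` B" by (intro image_eqI[of _ _ "- c + x"]) auto
    qed auto
    have "emeasure lborel B = emeasure (distr lborel borel ((+) (- c))) B" by (simp add: lborel_distr_plus)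
    also have "\<dots> = emeasure lborel ((+) (- c) -` B)" using that by (subst emeasure_distr) auto
    finally have "emeasure lborel ((+) c ` B) = emeasure lborel B" using eq by simp
    moreover have "(+) c ` B \<in> sets borel" unfolding eq by (rule measurable_sets_borel[OF _ that]) measurable
    ultimately show ?thesis by simp
  qed
  define A1 A2 where "A1 = A \<inter> {..<1 - s}" and "A2 = A \<inter> {1 - s..}"
  have [measurable]: "A1 \<in> sets borel" "A2 \<in> sets borel" using A by (auto simp: A1_def A2_def)
  have split: "A = A1 \<union> A2" "A1 \<inter> A2 = {}" by (auto simp: A1_def A2_def)
  have "frac (s + t) = s + t" if "t \<in> A1" for t
    using that A(2) s by (subst frac_eq) (auto simp: A1_def)
  moreover have "frac (s + t) = (s - 1) + t" if "t \<in> A2" for t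
    using that A(2) s by (subst frac_unique_iff) (auto simp: A2_def)
  ultimately have image: "(\<lambda>t. frac (s + t)) ` A = (+) s ` A1 \<union> (+) (s - 1) ` A2"
    unfolding split(1) image_Un by (metis (no_types, lifting) image_cong)
  have disj: "(+) s ` A1 \<inter> (+) (s - 1) ` A2 = {}"
  proof -
    have "s + t \<noteq> (s - 1) + t'" if "t \<in> A1" "t' \<in> A2" for t t'
    proof -
      have "0 \<le> t" "t' < 1" using that A(2) by (auto simp: A1_def A2_def)
      then show ?thesis by linarith
    qed
    then show ?thesis by blast
  qed
  show "(\<lambda>t. frac (s + t)) ` A \<in> sets borel" unfolding image using shift by auto
  have "emeasure lborel ((\<lambda>t. frac (s + t)) ` A) = emeasure lborel A1 + emeasure lborel A2"
    unfolding image using shift disj by (subst plus_emeasure[symmetric]) auto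
  also have "\<dots> = emeasure lborel A" using split by (subst plus_emeasure) auto
  finally show "emeasure lborel ((\<lambda>t. frac (s + t)) ` A) = emeasure lborel A" .
qed

definition circle_point :: "real \<Rightarrow> complex" where
  "circle_point t = cis (2 * pi * t)"

lemma circle_point_add: "circle_point (s + t) = circle_point s * circle_point t"
  by (simp add: circle_point_def cis_mult distrib_left)

lemma circle_point_frac: "circle_point (frac t) = circle_point t"
proof -
  have "circle_point t = circle_point (of_int \<lfloor>t\<rfloor>) * circle_point (frac t)"
    unfolding circle_point_add[symmetric] by (simp add: frac_def)
  then show ?thesis by (simp add: circle_point_def cis_multiple_2pi)
qed

lemma Arg2pi_circle_point: "t \<in> {0..<1} \<Longrightarrow> Arg2pi (circle_point t) = 2 * pi * t"
  by (rule Arg2pi_unique[of 1]) (auto simp: circle_point_def cis_conv_exp)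

lemma bij_betw_circle_point: "bij_betw circle_point {0..<1} (sphere 0 1)"
  unfolding bij_betw_def
proof
  show "inj_on circle_point {0..<1}"
    by (rule inj_on_inverseI[of _ "\<lambda>z. Arg2pi z / (2 * pi)"]) (simp add: Arg2pi_circle_point)
  show "circle_point ` {0..<1} = sphere 0 1"
  proof (intro equalityI subsetI)
    fix z :: complex assume "z \<in> sphere 0 1"
    then have "z = circle_point (Arg2pi z / (2 * pi))"
      using Arg2pi_eq[of z] by (simp add: circle_point_def cis_conv_exp)
    moreover have "Arg2pi z / (2 * pi) \<in> {0..<1}" using Arg2pi[of z] by simp
    ultimately show "z \<in> circle_point ` {0..<1}" by blast
  qed (auto simp: circle_point_def)
qed

lemma circle_point_measurable [measurable]: "circle_point \<in> borel_measurable borel"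
  unfolding circle_point_def by (intro borel_measurable_continuous_onI continuous_intros)

text \<open>
  The wrapping map is not a homeomorphism, but the images of initial segments of \<open>[0, 1)\<close> are closed.
\<close>

lemma circle_point_image_borel:
  assumes "A \<in> sets borel" "A \<subseteq> {0..<1}"
  shows "circle_point ` A \<in> sets borel"
proof -
  have "A \<in> sigma_sets UNIV (range (\<lambda>a. {..a::real}))"
    using assms(1) by (simp add: borel_eq_atMost)
  then have "A \<in> (\<inter>) {0..<1} ` sigma_sets UNIV (range (\<lambda>a. {..a::real}))"
    using assms(2) by blast
  moreover have "{0..<1} \<in> sets (borel :: real measure)" by simp
  then have "{0..<1} \<in> sigma_sets UNIV (range (\<lambda>a. {..a::real}))" by (simp add: borel_eq_atMost)
  ultimately have generated: "A \<in> sigma_sets {0..<1} ((\<inter>) {0..<1} ` range (\<lambda>a. {..a::real}))"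
    using sigma_sets_Int[of "{0..<1}" UNIV "range (\<lambda>a. {..a::real})"] by simp
  have segment: "circle_point ` ({0..<1} \<inter> {..a}) \<in> sets borel" for a
  proof (cases "a < 1")
    case True
    then have "{0..<1} \<inter> {..a} = {0..a}" by auto
    moreover have "compact (circle_point ` {0..a})"
      unfolding circle_point_def by (intro compact_continuous_image continuous_intros) auto
    ultimately show ?thesis by (simp add: borel_compact)
  next
    case False
    then have "{0..<1} \<inter> {..a} = {0..<1}" by auto
    then show ?thesis using bij_betw_circle_point by (simp add: bij_betw_def borel_closed)
  qed
  show ?thesis
  proof (rule image_sigma_sets_inj[OF _ _ _ _ generated])
    show "inj_on circle_point {0..<1}" using bij_betw_circle_point by (simp add: bij_betw_def)
    show "circle_point ` {0..<1} \<in> sets borel"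
      using bij_betw_circle_point by (simp add: bij_betw_def borel_closed)
  qed (use segment in blast)+
qed

section \<open>Pulling back a compact metric space\<close>

lemma Metric_space_pullback:
  assumes "inj_on \<theta> G"
  shows "Metric_space G (\<lambda>x y. dist (\<theta> x) (\<theta> y))"
  using assms by unfold_locales (auto simp: dist_commute dist_triangle inj_on_eq_iff)

lemma openin_pullback:
  fixes \<theta> :: "'a \<Rightarrow> 'b :: metric_space"
  assumes "inj_on \<theta> G"
  shows "openin (Metric_space.mtopology G (\<lambda>x y. dist (\<theta> x) (\<theta> y))) U \<longleftrightarrow>
    (\<exists>W. open W \<and> U = G \<inter> \<theta> -` W)"
proof -
  interpret Metric_space G "\<lambda>x y. dist (\<theta> x) (\<theta> y)" using assms by (rule Metric_space_pullback)
  show ?thesis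
  proof
    assume U: "openin mtopology U"
    define W where "W = \<Union>{ball (\<theta> x) r |x r. x \<in> G \<and> mball x r \<subseteq> U}"
    have "open W" unfolding W_def by (intro open_Union) auto
    moreover have "U = G \<inter> \<theta> -` W"
    proof (intro equalityI subsetI)
      fix x assume "x \<in> U"
      moreover from this obtain r where "0 < r" "mball x r \<subseteq> U" using U by (auto simp: openin_mtopology)
      moreover have "x \<in> G" using \<open>x \<in> U\<close> openin_subset[OF U] by auto
      ultimately have "ball (\<theta> x) r \<in> {ball (\<theta> x) r |x r. x \<in> G \<and> mball x r \<subseteq> U}" "\<theta> x \<in> ball (\<theta> x) r"
        by auto
      then show "x \<in> G \<inter> \<theta> -` W" using \<open>x \<in> G\<close> unfolding W_def by blast
    next
      fix y assume "y \<in> G \<inter> \<theta> -` W"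
      then obtain x r where "x \<in> G" "mball x r \<subseteq> U" "\<theta> y \<in> ball (\<theta> x) r" "y \<in> G"
        unfolding W_def by auto
      then have "y \<in> mball x r" by simp
      then show "y \<in> U" using \<open>mball x r \<subseteq> U\<close> by blast
    qed
    ultimately show "\<exists>W. open W \<and> U = G \<inter> \<theta> -` W" by blast
  next
    assume "\<exists>W. open W \<and> U = G \<inter> \<theta> -` W"
    then obtain W where W: "open W" "U = G \<inter> \<theta> -` W" by blast
    show "openin mtopology U" unfolding openin_mtopology
    proof (intro conjI allI impI)
      fix x assume "x \<in> U"
      then obtain r where "0 < r" "ball (\<theta> x) r \<subseteq> W" using W by (auto elim: openE)
      then show "\<exists>r>0. mball x r \<subseteq> U" using W by (intro exI[of _ r]) auto
    qed (use W in auto)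
  qed
qed

lemma homeomorphic_map_pullback:
  fixes \<theta> :: "'a \<Rightarrow> 'b :: metric_space"
  assumes bij: "bij_betw \<theta> G S"
  shows "homeomorphic_map (Metric_space.mtopology G (\<lambda>x y. dist (\<theta> x) (\<theta> y))) (top_of_set S) \<theta>"
proof -
  have inj: "inj_on \<theta> G" and onto: "\<theta> ` G = S" using bij by (auto simp: bij_betw_def)
  interpret Metric_space G "\<lambda>x y. dist (\<theta> x) (\<theta> y)" using inj by (rule Metric_space_pullback)
  have cont: "continuous_map mtopology (top_of_set S) \<theta>"
    unfolding continuous_map
  proof (intro conjI allI impI)
    fix V assume "openin (top_of_set S) V"
    then obtain W where W: "open W" "V = S \<inter> W" by (auto simp: openin_open)
    have "{x \<in> topspace mtopology. \<theta> x \<in> V} = G \<inter> \<theta> -` W" using onto W by auto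
    then show "openin mtopology {x \<in> topspace mtopology. \<theta> x \<in> V}"
      unfolding openin_pullback[OF inj] using W by blast
  qed (use onto in auto)
  have "open_map mtopology (top_of_set S) \<theta>"
    unfolding open_map_def
  proof (intro allI impI)
    fix U assume "openin mtopology U"
    then obtain W where W: "open W" "U = G \<inter> \<theta> -` W" unfolding openin_pullback[OF inj] by blast
    then have "\<theta> ` U = S \<inter> W" using onto by auto
    then show "openin (top_of_set S) (\<theta> ` U)" using W by (auto simp: openin_open)
  qed
  then show ?thesis
    using cont onto inj by (intro bijective_open_imp_homeomorphic_map) auto
qed

lemma compact_polish_pullback:
  fixes \<theta> :: "'a \<Rightarrow> 'b :: {metric_space, second_countable_topology}"
  assumes bij: "bij_betw \<theta> G S" and S: "compact S"
  shows "polish_metric_space G (\<lambda>x y. dist (\<theta> x) (\<theta> y))"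
    and "compact_space (Metric_space.mtopology G (\<lambda>x y. dist (\<theta> x) (\<theta> y)))"
proof -
  have inj: "inj_on \<theta> G" using bij by (auto simp: bij_betw_def)
  interpret Metric_space G "\<lambda>x y. dist (\<theta> x) (\<theta> y)" using inj by (rule Metric_space_pullback)
  have hom: "mtopology homeomorphic_space top_of_set S"
    using homeomorphic_map_pullback[OF bij] by (rule homeomorphic_map_imp_homeomorphic_space)
  have "compact_space (top_of_set S)" using S by (simp add: compact_space_subtopology)
  then show comp: "compact_space mtopology" using homeomorphic_compact_space[OF hom] by simp
  have "separable_space (top_of_set S)"
  proof -
    obtain T where T: "countable T" "T \<subseteq> S" "S \<subseteq> closure T" by (rule separable)
    then have "top_of_set S closure_of T = S"
      by (auto simp: closure_of_subtopology Int_absorb1)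
    then show ?thesis using T by (auto simp: separable_space_def)
  qed
  then have "separable_space mtopology" using homeomorphic_separable_space[OF hom] by simp
  then show "polish_metric_space G (\<lambda>x y. dist (\<theta> x) (\<theta> y))"
    using comp Metric_space_axioms compact_space_imp_mcomplete by (simp add: polish_metric_space_def)
qed

text \<open>
  Regularity is inherited from the image measure on the complete separable space that contains \<open>S\<close>,
  where every finite Borel measure is regular.
\<close>

lemma haar_regularity_pullback:
  fixes \<theta> :: "'a \<Rightarrow> 'b :: {complete_space, second_countable_topology}"
  assumes bij: "bij_betw \<theta> G S" and fin: "finite_measure \<mu>" and diff: "diffused \<mu>" and sp: "space \<mu> = G"
    and meas [measurable]: "\<theta> \<in> borel_measurable \<mu>" and image: "\<And>A. A \<in> sets \<mu> \<Longrightarrow> \<theta> ` A \<in> sets borel"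
  shows "borel_sets (Metric_space.mtopology G (\<lambda>x y. dist (\<theta> x) (\<theta> y))) = sets \<mu>"
    and "haar_regularity (Metric_space.mtopology G (\<lambda>x y. dist (\<theta> x) (\<theta> y))) \<mu>"
proof -
  interpret finite_measure \<mu> by fact
  have inj: "inj_on \<theta> G" and onto: "\<theta> ` G = S" using bij by (auto simp: bij_betw_def)
  interpret Metric_space G "\<lambda>x y. dist (\<theta> x) (\<theta> y)" using inj by (rule Metric_space_pullback)
  have hom: "homeomorphic_map mtopology (top_of_set S) \<theta>" using bij by (rule homeomorphic_map_pullback)
  have sub: "A \<subseteq> G" if "A \<in> sets \<mu>" for A using sets.sets_into_space[OF that] sp by simp
  have pre_image: "\<theta> -` \<theta> ` A \<inter> G = A" if "A \<subseteq> G" for A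
    using that inj by (auto dest: inj_onD)
  have open_sets: "U \<in> sets \<mu>" if U: "openin mtopology U" for U
  proof -
    obtain W where "open W" "U = G \<inter> \<theta> -` W" using U unfolding openin_pullback[OF inj] by blast
    then show ?thesis using measurable_sets[OF meas, of W] sp by (simp add: Int_commute)
  qed
  show borel_sets: "borel_sets mtopology = sets \<mu>"
  proof (intro equalityI subsetI)
    fix A assume "A \<in> borel_sets mtopology"
    then show "A \<in> sets \<mu>" using sets.sigma_sets_subset[of "{U. openin mtopology U}" \<mu>] open_sets sp
      by (auto simp: borel_sets_def)
  next
    fix A assume A: "A \<in> sets \<mu>"
    let ?B = "sigma G {U. openin mtopology U}"
    have opens: "{U. openin mtopology U} \<subseteq> Pow G" using openin_subset[of mtopology] by fastforce
    have "\<theta> \<in> borel_measurable ?B"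
    proof (rule borel_measurableI)
      fix W :: "'b set" assume "open W"
      then have "openin mtopology (G \<inter> \<theta> -` W)" unfolding openin_pullback[OF inj] by blast
      then show "\<theta> -` W \<inter> space ?B \<in> sets ?B" using opens by (simp add: Int_commute)
    qed
    from measurable_sets[OF this image[OF A]] have "\<theta> -` \<theta> ` A \<inter> G \<in> sigma_sets G {U. openin mtopology U}"
      using opens by simp
    then show "A \<in> borel_sets mtopology" using pre_image[OF sub[OF A]] by (simp add: borel_sets_def)
  qed
  define \<nu> where "\<nu> = distr \<mu> borel \<theta>"
  have \<nu>: "emeasure \<nu> B = emeasure \<mu> (G \<inter> \<theta> -` B)" if "B \<in> sets borel" for B
    unfolding \<nu>_def using that sp by (simp add: emeasure_distr Int_commute)
  have \<nu>_image: "emeasure \<nu> (\<theta> ` A) = emeasure \<mu> A" if "A \<in> sets \<mu>" for A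
    using \<nu>[OF image[OF that]] pre_image[OF sub[OF that]] by (simp add: Int_commute)
  have sets_\<nu>: "sets \<nu> = sets borel" by (simp add: \<nu>_def)
  have "finite_measure \<nu>" unfolding \<nu>_def by (rule finite_measure_distr) measurable
  then have fin_\<nu>: "emeasure \<nu> (space \<nu>) \<noteq> \<infinity>" using finite_measure.emeasure_finite by auto
  have "outer_regular mtopology \<mu>"
    unfolding outer_regular_def
  proof (intro ballI antisym)
    fix E assume E: "E \<in> sets \<mu>"
    show "emeasure \<mu> E \<le> (INF U\<in>{U. E \<subseteq> U \<and> openin mtopology U}. emeasure \<mu> U)"
      by (rule INF_greatest) (use open_sets in \<open>auto intro: emeasure_mono\<close>)
    have "(INF U\<in>{U. E \<subseteq> U \<and> openin mtopology U}. emeasure \<mu> U)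
        \<le> (INF W\<in>{W. \<theta> ` E \<subseteq> W \<and> open W}. emeasure \<nu> W)"
    proof (rule INF_greatest)
      fix W assume "W \<in> {W. \<theta> ` E \<subseteq> W \<and> open W}"
      then have W: "\<theta> ` E \<subseteq> W" "open W" by auto
      then have "openin mtopology (G \<inter> \<theta> -` W)" "E \<subseteq> G \<inter> \<theta> -` W"
        using sub[OF E] unfolding openin_pullback[OF inj] by auto
      then have "(INF U\<in>{U. E \<subseteq> U \<and> openin mtopology U}. emeasure \<mu> U) \<le> emeasure \<mu> (G \<inter> \<theta> -` W)"
        by (intro INF_lower) auto
      then show "(INF U\<in>{U. E \<subseteq> U \<and> openin mtopology U}. emeasure \<mu> U) \<le> emeasure \<nu> W"
        using \<nu>[of W] W by simp
    qed
    also have "\<dots> = emeasure \<mu> E"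
      using Regularity.outer_regular[OF sets_\<nu> fin_\<nu> image[OF E]] \<nu>_image[OF E] by simp
    finally show "(INF U\<in>{U. E \<subseteq> U \<and> openin mtopology U}. emeasure \<mu> U) \<le> emeasure \<mu> E" .
  qed
  moreover have "inner_regular mtopology \<mu>"
    unfolding inner_regular_def
  proof (intro ballI antisym)
    fix E assume E: "E \<in> sets \<mu>"
    show "(SUP F\<in>{F. F \<subseteq> E \<and> compactin mtopology F}. emeasure \<mu> F) \<le> emeasure \<mu> E"
      by (rule SUP_least) (use E in \<open>auto intro: emeasure_mono\<close>)
    have "emeasure \<mu> E = (SUP K\<in>{K. K \<subseteq> \<theta> ` E \<and> compact K}. emeasure \<nu> K)"
      using Regularity.inner_regular[OF sets_\<nu> fin_\<nu> image[OF E]] \<nu>_image[OF E] by simp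
    also have "\<dots> \<le> (SUP F\<in>{F. F \<subseteq> E \<and> compactin mtopology F}. emeasure \<mu> F)"
    proof (rule SUP_least)
      fix K assume "K \<in> {K. K \<subseteq> \<theta> ` E \<and> compact K}"
      then have K: "K \<subseteq> \<theta> ` E" "compact K" by auto
      let ?F = "G \<inter> \<theta> -` K"
      have "\<theta> ` ?F = K" using K(1) sub[OF E] by blast
      moreover have "K \<subseteq> S" using K(1) sub[OF E] onto by auto
      ultimately have "compactin mtopology ?F"
        using homeomorphic_map_compactness[OF hom, of ?F] K(2) by (simp add: compactin_subtopology)
      moreover have "?F \<subseteq> E" using K(1) sub[OF E] inj by (auto dest: inj_onD)
      ultimately have "emeasure \<mu> ?F \<le> (SUP F\<in>{F. F \<subseteq> E \<and> compactin mtopology F}. emeasure \<mu> F)"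
        by (intro SUP_upper) auto
      then show "emeasure \<nu> K \<le> (SUP F\<in>{F. F \<subseteq> E \<and> compactin mtopology F}. emeasure \<mu> F)"
        using \<nu>[of K] K(2) by (simp add: borel_compact)
    qed
    finally show "emeasure \<mu> E \<le> (SUP F\<in>{F. F \<subseteq> E \<and> compactin mtopology F}. emeasure \<mu> F)" .
  qed
  moreover have "emeasure \<mu> K < \<infinity>" for K by (simp add: emeasure_eq_measure)
  ultimately show "haar_regularity mtopology \<mu>"
    using borel_sets diff sp by (simp add: haar_regularity_def borel_measure_def)
qed

section \<open>The group structure\<close>

text \<open>
  The product is addition modulo 1 in the coordinate \<open>\<phi>\<close>; in the circle coordinate \<open>\<theta>\<close> it is complex
  multiplication.  The first form gives invariance of \<open>\<mu>\<close>, the second the group axioms and continuity.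
  As the group is commutative, left invariance implies the other two kinds.
\<close>

theorem theorem3p1:
  fixes G :: "'a set" and \<rho> :: "'a \<Rightarrow> 'a \<Rightarrow> real" and \<mu> :: "'a measure"
  assumes "polish_metric_space G \<rho>"
    and "dense_in_itself (Metric_space.mtopology G \<rho>)"
    and "borel_measure (Metric_space.mtopology G \<rho>) \<mu>"
    and "prob_space \<mu>"
    and "diffused \<mu>"
  shows "\<exists>(\<rho>\<^sub>\<phi> :: 'a \<Rightarrow> 'a \<Rightarrow> real) (H :: 'a monoid).
    Metric_space G \<rho>\<^sub>\<phi> \<and> group H \<and> carrier H = G \<and>
    borel_sets (Metric_space.mtopology G \<rho>\<^sub>\<phi>) = borel_sets (Metric_space.mtopology G \<rho>) \<and>
    compact_polish_group H \<rho>\<^sub>\<phi> \<and>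
    prob_space \<mu> \<and> two_sided_haar_measure H \<rho>\<^sub>\<phi> \<mu> \<and>
    left_haar_measure H \<rho>\<^sub>\<phi> \<mu> \<and> right_haar_measure H \<rho>\<^sub>\<phi> \<mu>"
proof -
  interpret prob_space \<mu> by fact
  have "Metric_space G \<rho>" using assms(1) by (simp add: polish_metric_space_def)
  then have space_\<mu>: "space \<mu> = G" and sets_\<mu>: "sets \<mu> = borel_sets (Metric_space.mtopology G \<rho>)"
    using assms(3) by (simp_all add: borel_measure_def Metric_space.topspace_mtopology)
  obtain \<phi> :: "'a \<Rightarrow> real" where \<phi> [measurable]: "\<phi> \<in> borel_measurable \<mu>" and \<phi>_bij: "bij_betw \<phi> G {0..<1}"
    and \<phi>_image: "\<And>A. A \<in> sets \<mu> \<Longrightarrow> \<phi> ` A \<in> sets borel \<and> emeasure lborel (\<phi> ` A) = emeasure \<mu> A"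
    using isomorphism_with_unit_interval[OF assms(1,3,4,5)] by blast
  have \<phi>_range: "\<phi> x \<in> {0..<1}" if "x \<in> G" for x using \<phi>_bij that by (auto simp: bij_betw_def)
  have \<phi>_inj: "inj_on \<phi> G" using \<phi>_bij by (simp add: bij_betw_def)
  define \<theta> where "\<theta> x = circle_point (\<phi> x)" for x
  have \<theta>_bij: "bij_betw \<theta> G (sphere 0 1)"
    using bij_betw_trans[OF \<phi>_bij bij_betw_circle_point] by (simp add: \<theta>_def[abs_def] comp_def)
  have \<theta>_inj: "inj_on \<theta> G" using \<theta>_bij by (simp add: bij_betw_def)
  have \<theta>_meas [measurable]: "\<theta> \<in> borel_measurable \<mu>" unfolding \<theta>_def[abs_def] by measurable
  have sub: "A \<subseteq> G" if "A \<in> sets \<mu>" for A using sets.sets_into_space[OF that] space_\<mu> by simp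
  have \<theta>_image: "\<theta> ` A \<in> sets borel" if "A \<in> sets \<mu>" for A
  proof -
    have "\<theta> ` A = circle_point ` \<phi> ` A" by (auto simp: \<theta>_def)
    moreover have "\<phi> ` A \<subseteq> {0..<1}" using sub[OF that] \<phi>_range by auto
    ultimately show ?thesis using circle_point_image_borel \<phi>_image[OF that] by simp
  qed
  define d where "d x y = dist (\<theta> x) (\<theta> y)" for x y
  have d: "d = (\<lambda>x y. dist (\<theta> x) (\<theta> y))" by (simp add: fun_eq_iff d_def)
  interpret Metric_space G d unfolding d using \<theta>_inj by (rule Metric_space_pullback)
  have polish: "polish_metric_space G d" and comp: "compact_space mtopology"
    unfolding d by (rule compact_polish_pullback[OF \<theta>_bij compact_sphere])+
  have borel: "borel_sets mtopology = sets \<mu>" and regular: "haar_regularity mtopology \<mu>"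
    unfolding d by (rule haar_regularity_pullback[OF \<theta>_bij finite_measure_axioms assms(5) space_\<mu> \<theta>_meas \<theta>_image]; assumption)+
  have hom: "homeomorphic_map mtopology (top_of_set (sphere 0 1)) \<theta>"
    unfolding d by (rule homeomorphic_map_pullback[OF \<theta>_bij])
  define \<psi> where "\<psi> = the_inv_into G \<phi>"
  have \<psi>: "\<psi> t \<in> G" "\<phi> (\<psi> t) = t" if "t \<in> {0..<1}" for t
    using \<phi>_bij that the_inv_into_into[of \<phi> G t G] f_the_inv_into_f[of \<phi> G t] by (auto simp: \<psi>_def bij_betw_def)
  define H :: "'a monoid" where
    "H = \<lparr>carrier = G, mult = (\<lambda>x y. \<psi> (frac (\<phi> x + \<phi> y))), one = \<psi> 0\<rparr>"
  have carrier: "carrier H = G" by (simp add: H_def)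
  have frac_I: "frac t \<in> {0..<1}" for t :: real by (simp add: frac_lt_1)
  have mult_closed: "x \<otimes>\<^bsub>H\<^esub> y \<in> G" and \<phi>_mult: "\<phi> (x \<otimes>\<^bsub>H\<^esub> y) = frac (\<phi> x + \<phi> y)" for x y
    using \<psi>[OF frac_I] by (simp_all add: H_def)
  have \<theta>_mult: "\<theta> (x \<otimes>\<^bsub>H\<^esub> y) = \<theta> x * \<theta> y" for x y
    by (simp add: \<theta>_def \<phi>_mult circle_point_frac circle_point_add)
  have one_closed: "\<one>\<^bsub>H\<^esub> \<in> G" and \<theta>_one: "\<theta> \<one>\<^bsub>H\<^esub> = 1"
    using \<psi>[of 0] by (simp_all add: H_def \<theta>_def circle_point_def)
  have eqI: "x = y" if "\<theta> x = \<theta> y" "x \<in> G" "y \<in> G" for x y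
    using inj_onD[OF \<theta>_inj] that by blast
  have "comm_group H"
  proof (rule comm_groupI)
    fix x assume x: "x \<in> carrier H"
    have "\<psi> (frac (- \<phi> x)) \<otimes>\<^bsub>H\<^esub> x = \<one>\<^bsub>H\<^esub>"
    proof (rule eqI)
      have "\<theta> (\<psi> (frac (- \<phi> x)) \<otimes>\<^bsub>H\<^esub> x) = \<theta> (\<psi> (frac (- \<phi> x))) * \<theta> x" by (rule \<theta>_mult)
      also have "\<dots> = circle_point (- \<phi> x + \<phi> x)"
        by (simp only: \<theta>_def \<psi>(2)[OF frac_I] circle_point_frac circle_point_add)
      finally show "\<theta> (\<psi> (frac (- \<phi> x)) \<otimes>\<^bsub>H\<^esub> x) = \<theta> \<one>\<^bsub>H\<^esub>"
        by (simp add: \<theta>_one circle_point_def)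
    qed (fact mult_closed one_closed)+
    then show "\<exists>y\<in>carrier H. y \<otimes>\<^bsub>H\<^esub> x = \<one>\<^bsub>H\<^esub>" using \<psi>(1)[OF frac_I] carrier by blast
  next
    fix x y z
    show "x \<otimes>\<^bsub>H\<^esub> y \<otimes>\<^bsub>H\<^esub> z = x \<otimes>\<^bsub>H\<^esub> (y \<otimes>\<^bsub>H\<^esub> z)"
      by (rule eqI) (simp_all only: \<theta>_mult mult.assoc mult_closed)
    show "x \<otimes>\<^bsub>H\<^esub> y = y \<otimes>\<^bsub>H\<^esub> x"
      by (rule eqI) (simp_all only: \<theta>_mult mult.commute mult_closed)
  next
    fix x assume "x \<in> carrier H"
    then show "\<one>\<^bsub>H\<^esub> \<otimes>\<^bsub>H\<^esub> x = x"
      by (intro eqI) (simp_all only: \<theta>_mult \<theta>_one mult_1 mult_closed carrier)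
  qed (simp_all only: carrier mult_closed one_closed)
  then interpret H: comm_group H .
  have \<theta>_inv: "\<theta> (inv\<^bsub>H\<^esub> x) = cnj (\<theta> x)" if "x \<in> G" for x
  proof -
    have "\<theta> (inv\<^bsub>H\<^esub> x) * \<theta> x = 1" using that by (simp flip: \<theta>_mult add: \<theta>_one carrier)
    moreover have "\<theta> x * cnj (\<theta> x) = 1" by (simp add: \<theta>_def circle_point_def cis_cnj cis_mult)
    ultimately show ?thesis by (metis mult.assoc mult.left_neutral mult.right_neutral)
  qed
  have "continuous_map (prod_topology mtopology mtopology) mtopology (\<lambda>(x, y). inv\<^bsub>H\<^esub> x \<otimes>\<^bsub>H\<^esub> y)"
  proof -
    obtain \<eta> where \<eta>: "homeomorphic_maps mtopology (top_of_set (sphere 0 1)) \<theta> \<eta>"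
      using hom by (auto simp: homeomorphic_map_maps)
    have \<theta>_cont: "continuous_map mtopology euclidean \<theta>"
      using homeomorphic_imp_continuous_map[OF hom] by (simp add: continuous_map_in_subtopology)
    define pair where "pair p = (\<theta> (fst p), \<theta> (snd p))" for p
    define quot :: "complex \<times> complex \<Rightarrow> complex" where "quot p = cnj (fst p) * snd p" for p
    have "continuous_map (prod_topology mtopology mtopology) (prod_topology euclidean euclidean) pair"
      unfolding pair_def
      using continuous_map_compose[OF continuous_map_fst \<theta>_cont] continuous_map_compose[OF continuous_map_snd \<theta>_cont]
      by (intro continuous_map_pairedI) (simp_all only: comp_def)
    then have "continuous_map (prod_topology mtopology mtopology) euclidean pair"
      by (simp only: prod_topology_euclidean)
    moreover have "continuous_on UNIV quot" unfolding quot_def by (intro continuous_intros)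
    then have "continuous_map euclidean euclidean quot" by simp
    ultimately have "continuous_map (prod_topology mtopology mtopology) euclidean (quot \<circ> pair)"
      by (rule continuous_map_compose)
    moreover have "(quot \<circ> pair) p \<in> sphere 0 1" for p
      by (simp add: quot_def pair_def norm_mult \<theta>_def circle_point_def)
    ultimately have "continuous_map (prod_topology mtopology mtopology) (top_of_set (sphere 0 1)) (quot \<circ> pair)"
      unfolding continuous_map_in_subtopology by blast
    moreover have "continuous_map (top_of_set (sphere 0 1)) mtopology \<eta>"
      using \<eta> by (simp add: homeomorphic_maps_def)
    ultimately have "continuous_map (prod_topology mtopology mtopology) mtopology (\<eta> \<circ> (quot \<circ> pair))"
      by (rule continuous_map_compose)
    then show ?thesis
    proof (rule continuous_map_eq)
      fix p assume "p \<in> topspace (prod_topology mtopology mtopology)"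
      then obtain x y where p: "p = (x, y)" "x \<in> G" by auto
      have "\<eta> (\<theta> (inv\<^bsub>H\<^esub> x \<otimes>\<^bsub>H\<^esub> y)) = inv\<^bsub>H\<^esub> x \<otimes>\<^bsub>H\<^esub> y"
        using \<eta> mult_closed by (simp add: homeomorphic_maps_def)
      then show "(\<eta> \<circ> (quot \<circ> pair)) p = (\<lambda>(x, y). inv\<^bsub>H\<^esub> x \<otimes>\<^bsub>H\<^esub> y) p"
        using p by (simp add: \<theta>_mult \<theta>_inv quot_def pair_def)
    qed
  qed
  then have compact_group: "compact_polish_group H d"
    using polish comp H.group_axioms by (simp add: compact_polish_group_def polish_group_def carrier)
  have pre_image: "A = \<phi> -` (\<phi> ` A) \<inter> space \<mu>" if "A \<subseteq> G" for A
    using that \<phi>_inj space_\<mu> by (auto dest: inj_onD)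
  have translate: "g <#\<^bsub>H\<^esub> E \<in> sets \<mu> \<and> emeasure \<mu> (g <#\<^bsub>H\<^esub> E) = emeasure \<mu> E"
    if g: "g \<in> G" and E: "E \<in> sets \<mu>" for g E
  proof -
    have \<phi>E: "\<phi> ` E \<in> sets borel" "\<phi> ` E \<subseteq> {0..<1}" using \<phi>_image[OF E] sub[OF E] \<phi>_range by auto
    note rotation = emeasure_lborel_rotation[OF \<phi>E, of "\<phi> g"]
    have image: "\<phi> ` (g <#\<^bsub>H\<^esub> E) = (\<lambda>t. frac (\<phi> g + t)) ` \<phi> ` E"
    proof -
      have "g <#\<^bsub>H\<^esub> E = (\<lambda>h. g \<otimes>\<^bsub>H\<^esub> h) ` E" by (auto simp: l_coset_def)
      then show ?thesis by (simp only: image_image \<phi>_mult)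
    qed
    have "g <#\<^bsub>H\<^esub> E \<subseteq> G" using mult_closed by (auto simp: l_coset_def)
    then have "g <#\<^bsub>H\<^esub> E = \<phi> -` (\<phi> ` (g <#\<^bsub>H\<^esub> E)) \<inter> space \<mu>"
      by (rule pre_image)
    also have "\<dots> \<in> sets \<mu>"
      unfolding image by (rule measurable_sets[OF \<phi> rotation(1)]) (use \<phi>_range[OF g] in auto)
    finally have meas: "g <#\<^bsub>H\<^esub> E \<in> sets \<mu>" .
    have "emeasure \<mu> (g <#\<^bsub>H\<^esub> E) = emeasure \<mu> E"
      using \<phi>_image[OF meas] \<phi>_image[OF E] rotation(2) \<phi>_range[OF g] unfolding image by simp
    with meas show ?thesis by simp
  qed
  have cosets: "E #>\<^bsub>H\<^esub> g = g <#\<^bsub>H\<^esub> E" if "g \<in> G" "E \<subseteq> G" for g E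
  proof -
    have "h \<otimes>\<^bsub>H\<^esub> g = g \<otimes>\<^bsub>H\<^esub> h" if "h \<in> E" for h
      using that \<open>g \<in> G\<close> \<open>E \<subseteq> G\<close> carrier by (intro H.m_comm) auto
    then show ?thesis unfolding r_coset_def l_coset_def by simp
  qed
  have left: "left_invariant H \<mu>" using translate by (simp add: left_invariant_def carrier)
  have right: "right_invariant H \<mu>" using translate cosets sub by (simp add: right_invariant_def carrier)
  have two_sided: "two_sided_invariant H \<mu>"
    unfolding two_sided_invariant_def carrier
  proof (intro ballI)
    fix g1 g2 E assume g: "g1 \<in> G" "g2 \<in> G" and E: "E \<in> sets \<mu>"
    have g1E: "g1 <#\<^bsub>H\<^esub> E \<in> sets \<mu>" using translate[OF g(1) E] by simp
    have "(g1 <#\<^bsub>H\<^esub> E) #>\<^bsub>H\<^esub> g2 = g2 <#\<^bsub>H\<^esub> (g1 <#\<^bsub>H\<^esub> E)" by (rule cosets[OF g(2) sub[OF g1E]])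
    then show "emeasure \<mu> ((g1 <#\<^bsub>H\<^esub> E) #>\<^bsub>H\<^esub> g2) = emeasure \<mu> E"
      using translate[OF g(2) g1E] translate[OF g(1) E] by simp
  qed
  have haar: "two_sided_haar_measure H d \<mu>" "left_haar_measure H d \<mu>" "right_haar_measure H d \<mu>"
    using regular left right two_sided
    unfolding two_sided_haar_measure_def left_haar_measure_def right_haar_measure_def carrier by blast+
  have same_borel: "borel_sets mtopology = borel_sets (Metric_space.mtopology G \<rho>)"
    using borel sets_\<mu> by (rule trans)
  show ?thesis
    by (rule exI[of _ d], rule exI[of _ H], intro conjI)
       (fact Metric_space_axioms H.group_axioms carrier same_borel compact_group assms(4) haar)+
qed

end
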